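(* If $\Gamma$ is a Fuchsian group of the first kind, then $\mathcal{E}_h(\Gamma)=\{h_0\}$, i.e. the only holomorphic $\Gamma$-equivariant function is the identity map $h_0(z)=z$ of $\mathbb{H}$.
   Context: $\mathbb{H}$ is the upper half-plane and $\widehat{\mathbb{C}}=\mathbb{C}\cup\{\infty\}$. $\mathrm{PSL}_2(\mathbb{R})=\mathrm{SL}_2(\mathbb{R})/\{\pm I\}$ acts on $\widehat{\mathbb{C}}$ by Möbius transformations, preserving $\mathbb{H}$ and $\mathbb{R}\cup\{\infty\}$. A Fuchsian group is a discrete subgroup $\Gamma$ of $\mathrm{PSL}_2(\mathbb{R})$; its limit set $\Lambda(\Gamma)\subset\mathbb{R}\cup\{\infty\}$ is the set of all limit points of orbits $\Gamma z$, $z\in\mathbb{H}$; it is of the first kind if $\Lambda(\Gamma)=\mathbb{R}\cup\{\infty\}$. $\mathcal{E}_h(\Gamma)$ is the set of holomorphic functions $h:\mathbb{H}\to\mathbb{C}$ such that $h(\gamma z)=\gamma(h(z))$ (in $\widehat{\mathbb{C}}$) for all $\gamma\in\Gamma$, $z\in\mathbb{H}$. *)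

theory Defs
  imports "HOL-Analysis.Analysis" "HOL-Algebra.Coset"
begin

definition SL2R :: "(real^2^2) monoid"
  where "SL2R = \<lparr>carrier = {A. det A = 1}, mult = (**), one = mat 1\<rparr>"

definition pm_id :: "(real^2^2) set"
  where "pm_id = {mat 1, - mat 1}"

text \<open>Elements of \<open>PSL2R\<close> are the cosets \<open>{A, -A}\<close> with \<open>det A = 1\<close>.\<close>

definition PSL2R :: "(real^2^2) set monoid"
  where "PSL2R = SL2R Mod pm_id"

lemma carrier_SL2R: "A \<in> carrier SL2R \<longleftrightarrow> det A = 1"
  by (simp add: SL2R_def)

lemma mult_SL2R: "A \<otimes>\<^bsub>SL2R\<^esub> B = A ** B"
  by (simp add: SL2R_def)

lemma one_SL2R: "\<one>\<^bsub>SL2R\<^esub> = mat 1"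
  by (simp add: SL2R_def)

lemma group_SL2R: "group SL2R"
proof (rule groupI)
  fix A assume "A \<in> carrier SL2R"
  hence A: "det A = 1" by (simp add: carrier_SL2R)
  hence "invertible A" by (simp add: invertible_det_nz)
  then obtain B where B: "B ** A = mat 1" by (auto simp: invertible_def)
  have "det B * det A = 1" using B by (metis det_I det_mul)
  thus "\<exists>B\<in>carrier SL2R. B \<otimes>\<^bsub>SL2R\<^esub> A = \<one>\<^bsub>SL2R\<^esub>"
    using A B by (auto simp: carrier_SL2R mult_SL2R one_SL2R)
qed (simp_all add: carrier_SL2R mult_SL2R one_SL2R det_mul matrix_mul_assoc)

lemma neg_matrix_mult:
  fixes A B :: "real^2^2"
  shows "(- A) ** B = - (A ** B)" and "A ** (- B) = - (A ** B)"
  by (simp_all add: vec_eq_iff matrix_matrix_mult_def sum_negf)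

lemma coset_SL2R: "pm_id #>\<^bsub>SL2R\<^esub> A = {A, - A}"
  by (auto simp: r_coset_def pm_id_def mult_SL2R neg_matrix_mult)

lemma normal_pm_id: "pm_id \<lhd> SL2R"
proof (rule group.normalI[OF group_SL2R])
  have det_neg: "det (- mat 1 :: real^2^2) = 1"
    by (simp add: det_2 mat_def)
  have inv_neg: "inv\<^bsub>SL2R\<^esub> (- mat 1) = - mat 1"
    by (rule group.inv_equality[OF group_SL2R])
       (simp_all add: carrier_SL2R mult_SL2R one_SL2R neg_matrix_mult det_neg)
  have inv_one: "inv\<^bsub>SL2R\<^esub> (mat 1) = mat 1"
    by (rule group.inv_equality[OF group_SL2R])
       (simp_all add: carrier_SL2R mult_SL2R one_SL2R)
  show "subgroup pm_id SL2R"
    by (rule group.subgroupI[OF group_SL2R])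
       (auto simp: pm_id_def carrier_SL2R mult_SL2R neg_matrix_mult det_neg inv_neg inv_one)
next
  show "\<forall>A\<in>carrier SL2R. pm_id #>\<^bsub>SL2R\<^esub> A = A <#\<^bsub>SL2R\<^esub> pm_id"
    unfolding coset_SL2R l_coset_def by (auto simp: pm_id_def mult_SL2R neg_matrix_mult)
qed

lemma group_PSL2R: "group PSL2R"
  unfolding PSL2R_def by (rule normal.factorgroup_is_group[OF normal_pm_id])

lemma carrier_PSL2R: "carrier PSL2R = {{A, - A} | A. det A = 1}"
  by (auto simp: PSL2R_def FactGroup_def RCOSETS_def coset_SL2R carrier_SL2R)

text \<open>The quotient of the topology that \<open>SL2R\<close> inherits from the space of matrices.\<close>

definition PSL2R_topology :: "(real^2^2) set topology"
  where "PSL2R_topology = topology (\<lambda>U. U \<subseteq> carrier PSL2R \<and>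
           openin (top_of_set (carrier SL2R)) {A \<in> carrier SL2R. pm_id #>\<^bsub>SL2R\<^esub> A \<in> U})"

lemma openin_PSL2R_topology:
  "openin PSL2R_topology U \<longleftrightarrow> U \<subseteq> carrier PSL2R \<and>
     openin (top_of_set (carrier SL2R)) {A \<in> carrier SL2R. pm_id #>\<^bsub>SL2R\<^esub> A \<in> U}"
proof -
  let ?pre = "\<lambda>U. {A \<in> carrier SL2R. pm_id #>\<^bsub>SL2R\<^esub> A \<in> U}"
  have "istopology (\<lambda>U. U \<subseteq> carrier PSL2R \<and> openin (top_of_set (carrier SL2R)) (?pre U))"
    unfolding istopology_def
  proof (intro conjI allI impI)
    fix S T
    assume S: "S \<subseteq> carrier PSL2R \<and> openin (top_of_set (carrier SL2R)) (?pre S)"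
      and T: "T \<subseteq> carrier PSL2R \<and> openin (top_of_set (carrier SL2R)) (?pre T)"
    show "S \<inter> T \<subseteq> carrier PSL2R" using S by blast
    have "?pre (S \<inter> T) = ?pre S \<inter> ?pre T" by blast
    thus "openin (top_of_set (carrier SL2R)) (?pre (S \<inter> T))"
      using S T by (simp only: openin_Int)
  next
    fix K
    assume K: "\<forall>S\<in>K. S \<subseteq> carrier PSL2R \<and> openin (top_of_set (carrier SL2R)) (?pre S)"
    show "\<Union>K \<subseteq> carrier PSL2R" using K by blast
    have "?pre (\<Union>K) = \<Union>(?pre ` K)" by blast
    thus "openin (top_of_set (carrier SL2R)) (?pre (\<Union>K))"
      using K by (simp only:) (rule openin_Union, blast)
  qed
  thus ?thesis by (simp add: PSL2R_topology_def)
qed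

lemma topspace_PSL2R_topology: "topspace PSL2R_topology = carrier PSL2R"
proof -
  have "{A \<in> carrier SL2R. pm_id #>\<^bsub>SL2R\<^esub> A \<in> carrier PSL2R} = carrier SL2R"
    by (auto simp: PSL2R_def FactGroup_def RCOSETS_def)
  hence "openin PSL2R_topology (carrier PSL2R)"
    by (simp add: openin_PSL2R_topology)
  thus ?thesis
    by (meson openin_PSL2R_topology openin_subset openin_topspace subset_antisym)
qed

lemma quotient_map_PSL2R:
  "quotient_map (top_of_set (carrier SL2R)) PSL2R_topology (\<lambda>A. pm_id #>\<^bsub>SL2R\<^esub> A)"
  by (auto simp: quotient_map_def topspace_PSL2R_topology openin_PSL2R_topology
      PSL2R_def FactGroup_def RCOSETS_def)

text \<open>The Riemann sphere is \<open>complex option\<close>, with \<open>None\<close> as the point at infinity.\<close>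

type_synonym rsphere = "complex option"

definition rsphere_topology :: "rsphere topology"
  where "rsphere_topology = Alexandroff_compactification euclidean"

definition upper_half_plane :: "complex set"
  where "upper_half_plane = {z. Im z > 0}"

definition extended_reals :: "rsphere set"
  where "extended_reals = insert None (Some ` \<real>)"

definition moebius :: "real^2^2 \<Rightarrow> rsphere \<Rightarrow> rsphere" where
  "moebius A p =
     (case p of
        None \<Rightarrow> if A$2$1 = 0 then None else Some (of_real (A$1$1 / A$2$1))
      | Some z \<Rightarrow>
          if of_real (A$2$1) * z + of_real (A$2$2) = 0 then None
          else Some ((of_real (A$1$1) * z + of_real (A$1$2)) /
                     (of_real (A$2$1) * z + of_real (A$2$2))))"

text \<open>The choice of the representative is immaterial; see \<open>psl_act_coset\<close>.\<close>

definition psl_act :: "(real^2^2) set \<Rightarrow> rsphere \<Rightarrow> rsphere"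
  where "psl_act \<gamma> = moebius (SOME A. A \<in> \<gamma>)"

lemma moebius_uminus: "moebius (- A) = moebius A"
proof
  fix p
  show "moebius (- A) p = moebius A p"
  proof (cases p)
    case None
    thus ?thesis by (simp add: moebius_def)
  next
    case (Some z)
    let ?n = "of_real (A$1$1) * z + of_real (A$1$2)"
    let ?d = "of_real (A$2$1) * z + of_real (A$2$2)"
    have "- (of_real (A$2$1) * z) - of_real (A$2$2) = - ?d"
         "- (of_real (A$1$1) * z) - of_real (A$1$2) = - ?n" by simp_all
    thus ?thesis unfolding moebius_def Some
      by (simp only: option.case uminus_vec_def vec_lambda_beta of_real_minus
          mult_minus_left add_uminus_conv_diff neg_equal_0_iff_equal minus_divide_divide)
  qed
qed

lemma psl_act_coset: "psl_act (pm_id #>\<^bsub>SL2R\<^esub> A) = moebius A"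
proof -
  have "(SOME B. B \<in> {A, - A}) \<in> {A, - A}" by (rule someI[of _ A]) simp
  thus ?thesis unfolding psl_act_def coset_SL2R by (auto simp: moebius_uminus)
qed

lemma psl_act_upper_half_plane:
  assumes "\<gamma> \<in> carrier PSL2R" "z \<in> upper_half_plane"
  shows "\<exists>w\<in>upper_half_plane. psl_act \<gamma> (Some z) = Some w"
proof -
  from assms(1) obtain A where A: "det A = 1" "\<gamma> = pm_id #>\<^bsub>SL2R\<^esub> A"
    by (auto simp: carrier_PSL2R coset_SL2R)
  let ?n = "of_real (A$1$1) * z + of_real (A$1$2)"
  let ?d = "of_real (A$2$1) * z + of_real (A$2$2)"
  have z: "Im z > 0" using assms(2) by (simp add: upper_half_plane_def)
  have det: "A$1$1 * A$2$2 - A$1$2 * A$2$1 = 1" using A(1) by (simp add: det_2)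
  have d: "?d \<noteq> 0"
  proof
    assume eq: "?d = 0"
    hence "Im ?d = 0" by (simp only: zero_complex.sel)
    hence "A$2$1 = 0" using z by simp
    with eq det show False by simp
  qed
  have "Im (?n * cnj ?d) = (A$1$1 * A$2$2 - A$1$2 * A$2$1) * Im z"
    by (simp add: algebra_simps)
  hence "Im (?n * cnj ?d) > 0" using z det by simp
  hence "Im (?n / ?d) > 0"
    using d by (subst complex_div_cnj) (auto simp: Im_divide_of_real simp flip: of_real_power)
  thus ?thesis using d
    by (simp add: A(2) psl_act_coset moebius_def upper_half_plane_def)
qed

definition fuchsian_group :: "(real^2^2) set set \<Rightarrow> bool"
  where "fuchsian_group \<Gamma> \<longleftrightarrow>
           subgroup \<Gamma> PSL2R \<and> subtopology PSL2R_topology \<Gamma> = discrete_topology \<Gamma>"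

definition orbit :: "(real^2^2) set set \<Rightarrow> complex \<Rightarrow> rsphere set"
  where "orbit \<Gamma> z = (\<lambda>\<gamma>. psl_act \<gamma> (Some z)) ` \<Gamma>"

definition limit_set :: "(real^2^2) set set \<Rightarrow> rsphere set"
  where "limit_set \<Gamma> = (\<Union>z\<in>upper_half_plane. rsphere_topology derived_set_of orbit \<Gamma> z)"

definition first_kind :: "(real^2^2) set set \<Rightarrow> bool"
  where "first_kind \<Gamma> \<longleftrightarrow> limit_set \<Gamma> = extended_reals"

text \<open>
  Functions on the upper half-plane are represented by their extensional (i.e. \<open>undefined\<close>
  elsewhere) extensions to all of \<open>complex\<close>, so that equality of members is equality on
  the half-plane. By \<open>psl_act_upper_half_plane\<close>, \<open>psl_act \<gamma> (Some z)\<close> is of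
  the form \<open>Some w\<close> below, and the left-hand side is \<open>Some (h w)\<close>.
\<close>

definition equivariant_holomorphic :: "(real^2^2) set set \<Rightarrow> (complex \<Rightarrow> complex) set"
  where "equivariant_holomorphic \<Gamma> =
    {h \<in> extensional upper_half_plane.
       h holomorphic_on upper_half_plane \<and>
       (\<forall>\<gamma>\<in>\<Gamma>. \<forall>z\<in>upper_half_plane.
          map_option h (psl_act \<gamma> (Some z)) = psl_act \<gamma> (Some (h z)))}"

end

theory Submission
  imports Defs "HOL-Complex_Analysis.Conformal_Mappings"
begin

text \<open>
  An equivariant \<open>h\<close> omits the orbit of infinity, which is dense in the real line because \<open>\<Gamma>\<close>
  is of the first kind; so by the open mapping theorem \<open>h\<close> has no real values, and up to sign it
  maps the half-plane into itself. The group contains a hyperbolic element; conjugate it to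
  \<open>z \<mapsto> k * z\<close>. By the equality case of the Schwarz lemma, a holomorphic self-map of the
  half-plane commuting with \<open>z \<mapsto> k * z\<close> has the form \<open>z \<mapsto> c * z\<close>. If \<open>c\<close> were
  not 1, then every element of \<open>\<Gamma>\<close>, commuting with this map, would preserve its fixed point set
  consisting of 0 and infinity, and \<open>\<Gamma>\<close> would have at most two limit points.
\<close>

section \<open>Real two by two matrices and Moebius transformations\<close>

text \<open>The limit set is awkward to use directly: it lives on the sphere, its base point
  \<open>z\<close> varies with the limit point, and conjugation moves infinity. Hence the passage to
  the preimage of \<open>\<Gamma>\<close> among matrices and to limits \<open>M\<close> of rescaled
  elements. Their determinants tend to 0, so a nonzero \<open>M\<close> has rank one; its image is
  the limit point approached. Open conditions on \<open>M\<close>, such as nonzero trace or the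
  slope of its first column, then hold for some element of the group, while closed homogeneous
  relations valid on the whole group pass to every \<open>M\<close>. The hyperbolic element, the
  dense orbit of infinity and the absence of an invariant pair of points are all obtained in this
  way.

  That \<open>h\<close> omits the orbit of infinity is due to its values being finite: if
  \<open>h w\<close> were the image of infinity under \<open>A\<close>, then \<open>h\<close> would
  be infinite at the preimage of \<open>w\<close> under \<open>A\<close>. The possibility that
  \<open>h\<close> maps into the lower half-plane is not excluded separately; it appears as a
  negative \<open>c\<close> and falls to the same argument as any other \<open>c\<close> different
  from 1.\<close>

lemma mat2_eq_iff:
  fixes A B :: "real^2^2"
  shows "A = B \<longleftrightarrow> A$1$1 = B$1$1 \<and> A$1$2 = B$1$2 \<and> A$2$1 = B$2$1 \<and> A$2$2 = B$2$2"
  by (subst vec_eq_iff, subst forall_2, subst (1 2) vec_eq_iff, subst (1 2) forall_2) (rule conj_assoc)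

lemma real2_eq_iff:
  fixes u v :: "real^2"
  shows "u = v \<longleftrightarrow> u$1 = v$1 \<and> u$2 = v$2"
  by (subst vec_eq_iff, rule forall_2)

lemma mat2_mult_nth:
  fixes A B :: "real^2^2"
  shows "(A ** B)$i$j = A$i$1 * B$1$j + A$i$2 * B$2$j"
  by (simp add: matrix_matrix_mult_def sum_2)

lemma mat2_one_nth [simp]:
  "(mat 1 :: real^2^2)$1$1 = 1" "(mat 1 :: real^2^2)$1$2 = 0"
  "(mat 1 :: real^2^2)$2$1 = 0" "(mat 1 :: real^2^2)$2$2 = 1"
  by (simp_all add: mat_def)

lemma vec_mat2_nth:
  fixes A :: "real^2^2"
  shows "(l v* A)$j = A$1$j * l$1 + A$2$j * l$2"
  by (simp add: vector_matrix_mult_def sum_2)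

lemma tendsto_mat2_nth:
  assumes "(f \<longlongrightarrow> (M :: real^2^2)) F"
  shows "((\<lambda>n. f n $ i $ j) \<longlongrightarrow> M $ i $ j) F"
  by (intro tendsto_vec_nth assms)

lemma tendsto_matrix_mult:
  fixes f g :: "'b \<Rightarrow> real^2^2"
  assumes "(f \<longlongrightarrow> M) F" "(g \<longlongrightarrow> N) F"
  shows "((\<lambda>n. f n ** g n) \<longlongrightarrow> M ** N) F"
  by (intro vec_tendstoI) (auto simp: mat2_mult_nth intro!: tendsto_intros assms)

lemma ex_mat2: "\<exists>A :: real^2^2. A$1$1 = a \<and> A$1$2 = b \<and> A$2$1 = c \<and> A$2$2 = d"
  by (rule exI[of _ "vector [vector [a, b], vector [c, d]]"]) simp

text \<open>For determinant 1 and nonreal \<open>z\<close> the denominator does not vanish, so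
  sphere points can be avoided. Both half-planes are needed, since a priori \<open>h\<close> may
  take its values in the lower one.\<close>

definition mob :: "real^2^2 \<Rightarrow> complex \<Rightarrow> complex" where
  "mob A z = (of_real (A$1$1) * z + of_real (A$1$2)) / (of_real (A$2$1) * z + of_real (A$2$2))"

lemma mob_denom_nonzero:
  fixes A :: "real^2^2"
  assumes "det A = 1" "Im z \<noteq> 0"
  shows "of_real (A$2$1) * z + of_real (A$2$2) \<noteq> 0"
proof
  assume eq: "of_real (A$2$1) * z + of_real (A$2$2) = 0"
  hence "Im (of_real (A$2$1) * z + of_real (A$2$2)) = 0" by (simp only: zero_complex.sel)
  hence "A$2$1 = 0" using assms(2) by simp
  with eq assms(1) show False by (simp add: det_2)
qed

lemma Im_mob:
  assumes "det A = 1"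
  shows "Im (mob A z) = Im z / (norm (of_real (A$2$1) * z + of_real (A$2$2)))\<^sup>2"
proof -
  let ?n = "of_real (A$1$1) * z + of_real (A$1$2)"
  let ?d = "of_real (A$2$1) * z + of_real (A$2$2)"
  have "Im (?n * cnj ?d) = (A$1$1 * A$2$2 - A$1$2 * A$2$1) * Im z"
    by (simp add: algebra_simps)
  also have "\<dots> = Im z" using assms by (simp add: det_2)
  finally show ?thesis
    unfolding mob_def by (subst complex_div_cnj) (simp only: Im_divide_of_real flip: of_real_power)
qed

lemma Im_mob_pos_iff:
  assumes "det A = 1" "Im z \<noteq> 0"
  shows "0 < Im (mob A z) \<longleftrightarrow> 0 < Im z"
  using mob_denom_nonzero[OF assms] by (simp add: Im_mob assms(1) zero_less_divide_iff)

lemma Im_mob_nonzero: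
  assumes "det A = 1" "Im z \<noteq> 0"
  shows "Im (mob A z) \<noteq> 0"
  using mob_denom_nonzero[OF assms] assms by (simp add: Im_mob)

lemma mob_mult:
  assumes "det B = 1" "Im z \<noteq> 0"
  shows "mob (A ** B) z = mob A (mob B z)"
proof -
  have "of_real (B$2$1) * z + of_real (B$2$2) \<noteq> 0"
    by (rule mob_denom_nonzero[OF assms])
  then show ?thesis
    unfolding mob_def mat2_mult_nth
    by (simp add: divide_simps) (simp add: algebra_simps)
qed

lemma mob_one [simp]: "mob (mat 1) z = z"
  by (simp add: mob_def)

lemma moebius_eq_mob:
  assumes "det A = 1" "Im z \<noteq> 0"
  shows "moebius A (Some z) = Some (mob A z)"
  using mob_denom_nonzero[OF assms] by (simp add: moebius_def mob_def)

lemma holomorphic_on_mob: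
  assumes "det A = 1" "\<And>z. z \<in> S \<Longrightarrow> Im z \<noteq> 0"
  shows "mob A holomorphic_on S"
  unfolding mob_def using mob_denom_nonzero[OF assms(1)] assms(2)
  by (intro holomorphic_intros) auto

lemma matrix_inverse_commutes:
  fixes A B :: "real^2^2"
  assumes "A ** B = mat 1" shows "B ** A = mat 1"
  using assms by (simp add: matrix_left_right_inverse)

lemma det_of_inverse:
  fixes A B :: "real^2^2"
  assumes "A ** B = mat 1" "det A = 1" shows "det B = 1"
  using assms by (metis det_I det_mul mult_1)

section \<open>Maps commuting with a dilation\<close>

text \<open>The key estimate: the Schwarz lemma, read in the disc coordinate centred at \<open>\<i>\<close> and at
  \<open>h \<i>\<close>, can only be satisfied at \<open>k * \<i>\<close> with equality, since \<open>\<i>\<close> lies on the axis of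
  \<open>z \<mapsto> k * z\<close>, where the translation length is least.\<close>

lemma scaling_equivariant_upper:
  fixes h :: "complex \<Rightarrow> complex" and k :: real
  assumes hol: "h holomorphic_on {z. 0 < Im z}"
    and pos: "\<And>z. 0 < Im z \<Longrightarrow> 0 < Im (h z)"
    and k: "0 < k" "k \<noteq> 1"
    and equi: "\<And>z. 0 < Im z \<Longrightarrow> h (of_real k * z) = of_real k * h z"
  obtains c :: real where "0 < c" "\<And>z. 0 < Im z \<Longrightarrow> h z = of_real c * z"
proof -
  define w where "w = h \<i>"
  have w: "0 < Im w" using pos[of \<i>] by (simp add: w_def)
  \<comment> \<open>\<open>t\<close> is the inverse Cayley map taking 0 to \<open>\<i>\<close>;
    \<open>\<phi>\<close> is \<open>h\<close> read in disc coordinates that vanish at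
    \<open>\<i>\<close> and at \<open>w\<close>.\<close>
  define t where "t \<zeta> = \<i> * (1 + \<zeta>) / (1 - \<zeta>)" for \<zeta> :: complex
  define \<phi> where "\<phi> \<zeta> = (h (t \<zeta>) - w) / (h (t \<zeta>) - cnj w)" for \<zeta>
  have Im_t: "Im (t \<zeta>) > 0" if "norm \<zeta> < 1" for \<zeta>
  proof -
    have ne: "1 - \<zeta> \<noteq> 0" using that by auto
    have "Im (\<i> * (1 + \<zeta>) * cnj (1 - \<zeta>)) = 1 - (norm \<zeta>)\<^sup>2"
      by (simp add: cmod_power2) (simp add: algebra_simps power2_eq_square)
    also have "\<dots> > 0" using that by (simp add: power_less_one_iff abs_square_less_1)
    finally show ?thesis unfolding t_def
      using ne by (subst complex_div_cnj) (simp add: Im_divide_of_real flip: of_real_power)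
  qed
  have ne: "u - cnj w \<noteq> 0" if "Im u > 0" for u
    using that w by (auto simp: complex_eq_iff)
  have "norm (u - w) < norm (u - cnj w)" if "Im u > 0" for u
  proof -
    have "(norm (u - w))\<^sup>2 = (norm (u - cnj w))\<^sup>2 - 4 * Im u * Im w"
      unfolding cmod_power2 by (simp add: power2_eq_square algebra_simps)
    moreover have "4 * Im u * Im w > 0" using that w by simp
    ultimately have "(norm (u - w))\<^sup>2 < (norm (u - cnj w))\<^sup>2" by linarith
    then show ?thesis by (rule power2_less_imp_less) simp
  qed
  hence \<phi>_lt: "norm (\<phi> \<zeta>) < 1" if "norm \<zeta> < 1" for \<zeta>
    using pos[OF Im_t[OF that]] ne[OF pos[OF Im_t[OF that]]]
    by (simp add: \<phi>_def norm_divide)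
  have \<phi>_0: "\<phi> 0 = 0" by (simp add: \<phi>_def t_def w_def)
  have hol_t: "t holomorphic_on ball 0 1"
    unfolding t_def by (intro holomorphic_intros) auto
  have "(h \<circ> t) holomorphic_on ball 0 1"
    by (rule holomorphic_on_compose_gen[OF hol_t hol]) (use Im_t in auto)
  hence hol_\<phi>: "\<phi> holomorphic_on ball 0 1"
    unfolding \<phi>_def comp_def using ne pos Im_t by (intro holomorphic_intros) auto
  \<comment> \<open>The disc coordinate of \<open>k * \<i>\<close>; it is nonzero because
    \<open>k\<close> differs from 1.\<close>
  define r where "r = (k - 1) / (k + 1)"
  have r: "norm (complex_of_real r) < 1" "r \<noteq> 0"
    using k unfolding norm_of_real by (auto simp: r_def abs_if field_simps)
  have t_r: "t (of_real r) = of_real k * \<i>"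
  proof -
    have "1 + r = 2 * k / (k + 1)" "1 - r = 2 / (k + 1)"
      using k by (auto simp: r_def field_simps)
    hence "(1 + r) / (1 - r) = k" using k by simp
    hence "complex_of_real ((1 + r) / (1 - r)) = of_real k" by simp
    thus ?thesis by (simp add: t_def mult.commute flip: times_divide_eq_right)
  qed
  have ht_r: "h (t (of_real r)) = of_real k * w"
    unfolding t_r w_def by (rule equi) simp
  have \<phi>_r: "\<phi> (of_real r) = of_real (k - 1) * w / (of_real k * w - cnj w)"
    unfolding \<phi>_def ht_r by (simp add: algebra_simps)
  have kw: "of_real k * w - cnj w \<noteq> 0" using ne[of "of_real k * w"] k w by simp
  \<comment> \<open>The term with \<open>Re w\<close> measures how far \<open>w\<close> is from the
    imaginary axis. Dropping it gives the lower bound for \<open>\<phi>\<close> at \<open>r\<close>;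
    equality in the Schwarz lemma later forces it to vanish.\<close>
  have sq: "(norm (of_real k * w - cnj w))\<^sup>2 = ((k + 1) * norm w)\<^sup>2 - 4 * k * (Re w)\<^sup>2"
    by (simp add: cmod_power2 power_mult_distrib) (simp add: power2_eq_square algebra_simps)
  have ge: "norm (\<phi> (of_real r)) \<ge> norm (complex_of_real r)"
  proof -
    have "norm (of_real k * w - cnj w) \<le> (k + 1) * norm w"
      by (rule power2_le_imp_le) (use k sq in auto)
    moreover have "norm (of_real k * w - cnj w) > 0" using kw by simp
    ultimately have "\<bar>k - 1\<bar> * norm w / ((k + 1) * norm w) \<le> \<bar>k - 1\<bar> * norm w / norm (of_real k * w - cnj w)"
      by (intro divide_left_mono) (use k w in \<open>auto intro!: mult_pos_pos\<close>)
    moreover have "norm w > 0" using w by auto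
    moreover have "norm (\<phi> (of_real r)) = \<bar>k - 1\<bar> * norm w / norm (of_real k * w - cnj w)"
      unfolding \<phi>_r norm_mult norm_divide norm_of_real by simp
    ultimately show ?thesis unfolding norm_of_real using k by (simp add: r_def)
  qed
  note Schwarz = Schwarz_Lemma[OF hol_\<phi> \<phi>_0 \<phi>_lt r(1)]
  have eq: "norm (\<phi> (of_real r)) = norm (complex_of_real r)"
    using ge Schwarz(1) by simp
  obtain \<alpha> where \<alpha>: "\<And>z. norm z < 1 \<Longrightarrow> \<phi> z = \<alpha> * z"
    using Schwarz(3) eq r by (metis of_real_eq_0_iff)
  have "norm (of_real k * w - cnj w) = (k + 1) * norm w"
  proof -
    have "\<bar>k - 1\<bar> * norm w / norm (of_real k * w - cnj w) = \<bar>k - 1\<bar> / (k + 1)"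
      using eq k unfolding \<phi>_r norm_mult norm_divide norm_of_real by (simp add: r_def)
    hence "\<bar>k - 1\<bar> * norm (of_real k * w - cnj w) = \<bar>k - 1\<bar> * ((k + 1) * norm w)"
      using k kw by (simp add: field_simps)
    thus ?thesis using k by simp
  qed
  with sq have "Re w = 0" using k by simp
  define c where "c = Im w"
  have c: "c > 0" "w = of_real c * \<i>" using w \<open>Re w = 0\<close> by (auto simp: c_def complex_eq_iff)
  have "of_real k * w - cnj w = of_real (k + 1) * w" unfolding c(2) by (simp add: algebra_simps)
  moreover have "w \<noteq> 0" using w by auto
  ultimately have "\<phi> (of_real r) = of_real (k - 1) / of_real (k + 1)"
    unfolding \<phi>_r by simp
  \<comment> \<open>The rotation in the equality case is fixed by this one nonzero point, so
    \<open>\<phi>\<close> is the identity.\<close>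
  hence "\<phi> (of_real r) = of_real r" by (simp add: r_def)
  with \<alpha>[OF r(1)] r have "\<alpha> = 1" by simp
  show ?thesis
  proof (rule that[OF c(1)])
    fix z assume z: "0 < Im z"
    define \<zeta> where "\<zeta> = (z - \<i>) / (z + \<i>)"
    have z1: "z + \<i> \<noteq> 0" using z by (auto simp: complex_eq_iff)
    have "(norm (z - \<i>))\<^sup>2 < (norm (z + \<i>))\<^sup>2"
      unfolding cmod_power2 using z by (simp add: power2_eq_square algebra_simps)
    hence "norm (z - \<i>) < norm (z + \<i>)" by (rule power2_less_imp_less) simp
    hence \<zeta>: "norm \<zeta> < 1" using z1 by (simp add: \<zeta>_def norm_divide)
    have "1 + \<zeta> = 2 * z / (z + \<i>)" "1 - \<zeta> = 2 * \<i> / (z + \<i>)"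
      using z1 by (simp_all add: \<zeta>_def field_simps)
    hence tz: "t \<zeta> = z" using z1 by (simp add: t_def)
    have "(h z - w) / (h z - cnj w) = (z - \<i>) / (z + \<i>)"
      using \<alpha>[OF \<zeta>] \<open>\<alpha> = 1\<close> unfolding \<phi>_def tz by (simp add: \<zeta>_def)
    hence "(h z - w) * (z + \<i>) = (z - \<i>) * (h z - cnj w)"
      using z1 ne[OF pos[OF z]] by (simp add: frac_eq_eq)
    hence "2 * \<i> * (h z - of_real c * z) = 0" unfolding c(2) by (simp add: algebra_simps)
    thus "h z = of_real c * z" by simp
  qed
qed

text \<open>By connectedness \<open>Im (h z)\<close> has constant sign. If it is negative,
  \<open>- h\<close> is used: it is still holomorphic and, dilations being linear, still commutes
  with them. The sign is absorbed into \<open>c\<close>.\<close>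

lemma scaling_equivariant_nonreal:
  fixes h :: "complex \<Rightarrow> complex" and k :: real
  assumes hol: "h holomorphic_on {z. 0 < Im z}"
    and nonreal: "\<And>z. 0 < Im z \<Longrightarrow> Im (h z) \<noteq> 0"
    and k: "0 < k" "k \<noteq> 1"
    and equi: "\<And>z. 0 < Im z \<Longrightarrow> h (of_real k * z) = of_real k * h z"
  obtains c :: real where "c \<noteq> 0" "\<And>z. 0 < Im z \<Longrightarrow> h z = of_real c * z"
proof -
  let ?H = "{z. 0 < Im z}"
  have "connected ((\<lambda>z. Im (h z)) ` ?H)"
    by (intro connected_continuous_image continuous_intros holomorphic_on_imp_continuous_on hol
        convex_connected convex_halfspace_Im_gt)
  hence conn: "is_interval ((\<lambda>z. Im (h z)) ` ?H)" by (simp add: is_interval_connected_1)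
  have "(\<forall>z\<in>?H. Im (h z) > 0) \<or> (\<forall>z\<in>?H. Im (h z) < 0)"
  proof (rule ccontr)
    assume "\<not> ?thesis"
    then obtain a b where "a \<in> ?H" "b \<in> ?H" "Im (h a) \<le> 0" "Im (h b) \<ge> 0" by force
    hence "0 \<in> (\<lambda>z. Im (h z)) ` ?H" using conn unfolding is_interval_1 by blast
    thus False using nonreal by force
  qed
  thus ?thesis
  proof
    assume "\<forall>z\<in>?H. Im (h z) > 0"
    then obtain c where "0 < c" "\<And>z. 0 < Im z \<Longrightarrow> h z = of_real c * z"
      using scaling_equivariant_upper[OF hol _ k equi] by (metis mem_Collect_eq)
    thus ?thesis using that[of c] by simp
  next
    assume *: "\<forall>z\<in>?H. Im (h z) < 0"
    have "(\<lambda>z. - h z) holomorphic_on ?H" by (intro holomorphic_intros hol)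
    then obtain c where c: "0 < c" "\<And>z. 0 < Im z \<Longrightarrow> - h z = of_real c * z"
      using scaling_equivariant_upper[of "\<lambda>z. - h z" k] * k equi
      by (metis (no_types, lifting) mem_Collect_eq minus_mult_commute mult_minus_right neg_0_less_iff_less uminus_complex.sel(2))
    have "h z = of_real (- c) * z" if "0 < Im z" for z
      using c(2)[OF that] by (metis minus_equation_iff mult_minus_left of_real_minus)
    thus ?thesis using that[of "- c"] c(1) by simp
  qed
qed

section \<open>Matrix groups with many limit points\<close>

text \<open>The scale \<open>r\<close> is left free instead of being the norm of \<open>A n\<close>,
  so that multiplication by a fixed matrix and conjugation leave it unchanged.\<close>

definition asymptotic :: "(real^2^2) set \<Rightarrow> real^2^2 \<Rightarrow> bool" where
  "asymptotic G M \<longleftrightarrow> M \<noteq> 0 \<and> (\<exists>A r. (\<forall>n. A n \<in> G) \<and>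
     filterlim r at_top sequentially \<and> (\<lambda>n. (1 / r n) *\<^sub>R A n) \<longlonglongrightarrow> M)"

lemma asymptoticI:
  assumes "M \<noteq> 0" "\<And>n. A n \<in> G" "filterlim r at_top sequentially"
    "(\<lambda>n. (1 / r n) *\<^sub>R A n) \<longlonglongrightarrow> M"
  shows "asymptotic G M"
  using assms unfolding asymptotic_def by blast

lemma asymptoticE:
  assumes "asymptotic G M"
  obtains A r where "M \<noteq> 0" "\<And>n. A n \<in> G" "filterlim r at_top sequentially"
    "\<And>i j. (\<lambda>n. A n $ i $ j / r n) \<longlonglongrightarrow> M $ i $ j" "\<And>n. r n > 0"
proof -
  obtain A r where *: "M \<noteq> 0" "\<And>n. A n \<in> G" "filterlim r at_top sequentially"
    "(\<lambda>n. (1 / r n) *\<^sub>R A n) \<longlonglongrightarrow> M"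
    using assms unfolding asymptotic_def by blast
  \<comment> \<open>Dropping finitely many terms makes \<open>r\<close> positive throughout, so that
    it can be cancelled freely.\<close>
  have "eventually (\<lambda>n. r n > 0) sequentially"
    using *(3) by (simp add: filterlim_at_top_dense)
  then obtain N where N: "\<And>n. n \<ge> N \<Longrightarrow> r n > 0"
    by (auto simp: eventually_sequentially)
  show ?thesis
  proof (rule that[of "\<lambda>n. A (n + N)" "\<lambda>n. r (n + N)"])
    show "filterlim (\<lambda>n. r (n + N)) at_top sequentially"
      using filterlim_compose[OF *(3) filterlim_add_const_nat_at_top] .
    fix i j
    from tendsto_mat2_nth[OF *(4)] have "(\<lambda>n. A n $ i $ j / r n) \<longlonglongrightarrow> M $ i $ j" by simp
    thus "(\<lambda>n. A (n + N) $ i $ j / r (n + N)) \<longlonglongrightarrow> M $ i $ j"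
      by (rule LIMSEQ_ignore_initial_segment)
  qed (use * N in auto)
qed

lemma scaleR_mat2_mult:
  fixes A B :: "real^2^2"
  shows "(c *\<^sub>R A) ** B = c *\<^sub>R (A ** B)" and "A ** (c *\<^sub>R B) = c *\<^sub>R (A ** B)"
  by (simp_all add: mat2_eq_iff mat2_mult_nth algebra_simps)

text \<open>Right multiplication keeps the left kernel, hence the limit point, but moves the right
  kernel. It serves to repair an \<open>M\<close> whose kernel is in a bad position.\<close>

lemma asymptotic_mult_right:
  assumes "asymptotic G M" "B \<in> G" "M ** B \<noteq> 0"
    and mult: "\<And>A. A \<in> G \<Longrightarrow> A ** B \<in> G"
  shows "asymptotic G (M ** B)"
proof -
  obtain A r where *: "\<And>n. A n \<in> G" "filterlim r at_top sequentially"
    "(\<lambda>n. (1 / r n) *\<^sub>R A n) \<longlonglongrightarrow> M"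
    using assms unfolding asymptotic_def by blast
  from tendsto_matrix_mult[OF *(3) tendsto_const[of B]]
  have "(\<lambda>n. (1 / r n) *\<^sub>R (A n ** B)) \<longlonglongrightarrow> M ** B"
    by (simp add: scaleR_mat2_mult)
  thus ?thesis by (rule asymptoticI[OF assms(3) mult[OF *(1)] *(2)])
qed

lemma asymptotic_conj:
  fixes P Q :: "real^2^2"
  assumes M: "asymptotic G M" and PQ: "P ** Q = mat 1"
  shows "asymptotic ((\<lambda>A. P ** A ** Q) ` G) (P ** M ** Q)"
proof -
  obtain A r where *: "\<And>n. A n \<in> G" "filterlim r at_top sequentially"
    "(\<lambda>n. (1 / r n) *\<^sub>R A n) \<longlonglongrightarrow> M"
    using M unfolding asymptotic_def by blast
  have "Q ** (P ** M ** Q) ** P = (Q ** P) ** M ** (Q ** P)"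
    by (simp add: matrix_mul_assoc)
  hence "Q ** (P ** M ** Q) ** P = M"
    by (simp add: matrix_inverse_commutes[OF PQ])
  moreover have "Q ** 0 ** P = 0" by (simp add: vec_eq_iff matrix_matrix_mult_def)
  ultimately have nz: "P ** M ** Q \<noteq> 0" using M by (auto simp: asymptotic_def)
  have "(\<lambda>n. P ** ((1 / r n) *\<^sub>R A n) ** Q) \<longlonglongrightarrow> P ** M ** Q"
    by (intro tendsto_matrix_mult *(3) tendsto_const)
  hence "(\<lambda>n. (1 / r n) *\<^sub>R (P ** A n ** Q)) \<longlonglongrightarrow> P ** M ** Q"
    by (simp add: scaleR_mat2_mult)
  moreover have "P ** A n ** Q \<in> (\<lambda>A. P ** A ** Q) ` G" for n using *(1) by blast
  ultimately show ?thesis using asymptoticI[OF nz _ *(2), of "\<lambda>n. P ** A n ** Q"] by simp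
qed

text \<open>Being of the first kind enters in the following conjugation invariant form: all lines but
  possibly one occur as the left kernel of a limit of rescaled elements of the group. If the
  rescaled elements converge to \<open>M\<close>, the left kernel of \<open>M\<close> is the limit point they approach.\<close>

locale first_kind_matrix_group =
  fixes G :: "(real^2^2) set"
  assumes det: "A \<in> G \<Longrightarrow> det A = 1"
    and mult: "A \<in> G \<Longrightarrow> B \<in> G \<Longrightarrow> A ** B \<in> G"
    and inverse: "A \<in> G \<Longrightarrow> \<exists>B\<in>G. A ** B = mat 1"
    and discrete: "(\<And>n. f n \<in> G) \<Longrightarrow> f \<longlonglongrightarrow> mat 1 \<Longrightarrow> \<exists>n::nat. f n = mat 1 \<or> f n = - mat 1"
    and limits: "\<exists>m::real^2. m \<noteq> 0 \<and> (\<forall>l. l$1 * m$2 \<noteq> l$2 * m$1 \<longrightarrow> (\<exists>M. asymptotic G M \<and> l v* M = 0))"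
begin

text \<open>This allows any real point to be moved to infinity, and a hyperbolic element to be made
  diagonal.\<close>

lemma conjugate:
  assumes PQ: "P ** Q = mat 1" and "det P = 1"
  shows "first_kind_matrix_group ((\<lambda>A. P ** A ** Q) ` G)"
proof
  have QP: "Q ** P = mat 1" by (rule matrix_inverse_commutes[OF PQ])
  have cancel: "P ** A ** Q ** (P ** B ** Q) = P ** (A ** B) ** Q" for A B
    by (metis QP matrix_mul_assoc matrix_mul_rid)
  have restore: "Q ** (P ** A ** Q) ** P = A" for A
    by (metis QP matrix_mul_assoc matrix_mul_rid matrix_mul_lid)
  have "det Q = 1" by (rule det_of_inverse[OF PQ]) fact
  show "det A = 1" if "A \<in> (\<lambda>A. P ** A ** Q) ` G" for A
    using that det \<open>det P = 1\<close> \<open>det Q = 1\<close> by (auto simp: det_mul)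
  show "A ** B \<in> (\<lambda>A. P ** A ** Q) ` G"
    if "A \<in> (\<lambda>A. P ** A ** Q) ` G" "B \<in> (\<lambda>A. P ** A ** Q) ` G" for A B
    using that mult by (auto simp: cancel)
  show "\<exists>B\<in>(\<lambda>A. P ** A ** Q) ` G. A ** B = mat 1" if A: "A \<in> (\<lambda>A. P ** A ** Q) ` G" for A
  proof -
    obtain A' where "A' \<in> G" "A = P ** A' ** Q" using A by blast
    moreover obtain B where "B \<in> G" "A' ** B = mat 1" using inverse[OF \<open>A' \<in> G\<close>] by blast
    ultimately show ?thesis by (intro bexI[of _ "P ** B ** Q"]) (simp_all add: cancel PQ)
  qed
  show "\<exists>n. f n = mat 1 \<or> f n = - mat 1"
    if f: "\<And>n. f n \<in> (\<lambda>A. P ** A ** Q) ` G" "f \<longlonglongrightarrow> mat 1" for f :: "nat \<Rightarrow> real^2^2"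
  proof -
    have "(\<lambda>n. Q ** f n ** P) \<longlonglongrightarrow> Q ** mat 1 ** P"
      by (intro tendsto_matrix_mult tendsto_const f(2))
    hence "(\<lambda>n. Q ** f n ** P) \<longlonglongrightarrow> mat 1" by (simp add: QP)
    moreover have "Q ** f n ** P \<in> G" for n using f(1)[of n] by (auto simp: restore)
    ultimately obtain n where n: "Q ** f n ** P = mat 1 \<or> Q ** f n ** P = - mat 1"
      using discrete[of "\<lambda>n. Q ** f n ** P"] by blast
    have "f n = P ** (Q ** f n ** P) ** Q"
      by (metis PQ matrix_mul_assoc matrix_mul_rid matrix_mul_lid)
    with n show ?thesis by (auto simp: neg_matrix_mult PQ intro!: exI[of _ n])
  qed
  obtain m :: "real^2" where m: "m \<noteq> 0"
    "\<And>l. l$1 * m$2 \<noteq> l$2 * m$1 \<Longrightarrow> \<exists>M. asymptotic G M \<and> l v* M = 0"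
    using limits by blast
  show "\<exists>m::real^2. m \<noteq> 0 \<and> (\<forall>l. l$1 * m$2 \<noteq> l$2 * m$1 \<longrightarrow>
      (\<exists>M. asymptotic ((\<lambda>A. P ** A ** Q) ` G) M \<and> l v* M = 0))"
  proof (intro exI[of _ "m v* Q"] conjI allI impI)
    have "(m v* Q) v* P = m" by (simp add: vector_matrix_mul_assoc QP)
    with m(1) show "m v* Q \<noteq> 0" by auto
    fix l :: "real^2"
    assume l: "l$1 * (m v* Q)$2 \<noteq> l$2 * (m v* Q)$1"
    have lPQ: "(l v* P) v* Q = l" by (simp add: vector_matrix_mul_assoc PQ)
    \<comment> \<open>The exceptional line moves with the conjugation; independence of two rows is
      tested by a determinant, which is multiplied by \<open>det Q\<close>.\<close>
    have "(u v* Q)$1 * (m v* Q)$2 - (u v* Q)$2 * (m v* Q)$1 = det Q * (u$1 * m$2 - u$2 * m$1)" for u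
      by (simp add: vec_mat2_nth det_2 algebra_simps)
    from this[of "l v* P"] l \<open>det Q = 1\<close>
    have "(l v* P)$1 * m$2 \<noteq> (l v* P)$2 * m$1" unfolding lPQ by auto
    then obtain M where M: "asymptotic G M" "(l v* P) v* M = 0" using m(2) by blast
    have "l v* (P ** M ** Q) = ((l v* P) v* M) v* Q"
      by (simp add: vector_matrix_mul_assoc)
    also have "\<dots> = 0" unfolding M(2) by (simp add: vec_eq_iff vector_matrix_mult_def)
    finally show "\<exists>M. asymptotic ((\<lambda>A. P ** A ** Q) ` G) M \<and> l v* M = 0"
      using asymptotic_conj[OF M(1) PQ] by blast
  qed
qed

text \<open>The left kernel contains the row (1, t), so the columns of \<open>M\<close> are
  multiples of (-t, 1): the limit point is \<open>- t\<close>, not \<open>t\<close>.\<close>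

lemma ex_asymptotic:
  assumes "a < b"
  obtains t M where "a < t" "t < b" "asymptotic G M"
    "M$1$1 = - t * M$2$1" "M$1$2 = - t * M$2$2"
proof -
  obtain m :: "real^2" where m: "m \<noteq> 0"
    "\<And>l. l$1 * m$2 \<noteq> l$2 * m$1 \<Longrightarrow> \<exists>M. asymptotic G M \<and> l v* M = 0"
    using limits by blast
  \<comment> \<open>The removed value is the one for which (1, t) lies on the exceptional line. If
    \<open>m$1 = 0\<close> the quotient is 0 by convention, and removing 0 does no harm.\<close>
  have "infinite ({a<..<b} - {m$2 / m$1})"
    using assms by (intro Diff_infinite_finite) (simp_all add: infinite_Ioo)
  then obtain t where "t \<in> {a<..<b} - {m$2 / m$1}"
    by (metis ex_in_conv finite.emptyI)
  hence t: "a < t" "t < b" "t \<noteq> m$2 / m$1" by simp_all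
  obtain l :: "real^2" where l: "l$1 = 1" "l$2 = t"
    using that[of "vector [1, t]"] by simp
  have "m$1 \<noteq> 0 \<or> m$2 \<noteq> 0" using m(1) by (auto simp: real2_eq_iff)
  hence "l$1 * m$2 \<noteq> l$2 * m$1" using t(3) l by (auto simp: field_simps)
  then obtain M where M: "asymptotic G M" "l v* M = 0" using m(2) by blast
  have "(l v* M)$1 = 0" "(l v* M)$2 = 0" using M(2) by simp_all
  hence "M$1$1 = - t * M$2$1" "M$1$2 = - t * M$2$2" using l by (auto simp: vec_mat2_nth algebra_simps)
  thus ?thesis using that[of t M] t M(1) by blast
qed

text \<open>If every element fixed infinity, then commutators would be translations. Conjugating a
  nontrivial one by powers of an element with diagonal entry of modulus above 1 would make it
  arbitrarily small, against discreteness; so the group would be abelian, with two fixed points.\<close>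

lemma ex_not_upper_triangular: "\<exists>A\<in>G. A$2$1 \<noteq> 0"
proof (rule ccontr)
  assume "\<not> ?thesis"
  hence tri: "\<And>A. A \<in> G \<Longrightarrow> A$2$1 = 0" by blast
  have diag: "A$1$1 * A$2$2 = 1" if "A \<in> G" for A
    using det[OF that] tri[OF that] by (simp add: det_2)
  obtain t M where "asymptotic G M" and M: "M$1$1 = - t * M$2$1" "M$1$2 = - t * M$2$2"
    using ex_asymptotic[OF zero_less_one] by blast
  then obtain A r where A: "M \<noteq> 0" "\<And>n. A n \<in> G" "filterlim r at_top sequentially"
    "\<And>i j. (\<lambda>n. A n $ i $ j / r n) \<longlonglongrightarrow> M $ i $ j" "\<And>n. r n > 0"
    by (elim asymptoticE) blast
  have "M$2$1 = 0"
    using A(4)[of 2 1] tri[OF A(2)] by (simp add: LIMSEQ_const_iff)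
  hence M22: "M$2$2 \<noteq> 0" using M A(1) by (auto simp: mat2_eq_iff)
  \<comment> \<open>Only the second column of \<open>M\<close> survives, with nonzero lower entry,
    so the lower right entries of \<open>A n\<close> grow like \<open>r n\<close>.\<close>
  have "\<exists>D\<in>G. \<bar>D$2$2\<bar> > 1"
  proof -
    have "filterlim (\<lambda>n. r n * \<bar>A n $ 2 $ 2 / r n\<bar>) at_top sequentially"
      by (rule filterlim_at_top_mult_tendsto_pos[OF tendsto_rabs[OF A(4)] _ A(3), folded mult.commute])
         (use M22 in auto)
    hence "eventually (\<lambda>n. 1 < r n * \<bar>A n $ 2 $ 2 / r n\<bar>) sequentially"
      by (simp add: filterlim_at_top_dense)
    then obtain n where "1 < r n * \<bar>A n $ 2 $ 2 / r n\<bar>"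
      by (auto simp: eventually_sequentially)
    hence "1 < \<bar>A n $ 2 $ 2\<bar>" using A(5)[of n] by (simp add: abs_divide)
    thus ?thesis using A(2) by blast
  qed
  then obtain D where D: "D \<in> G" "\<bar>D$2$2\<bar> > 1" by blast
  obtain D' where D': "D' \<in> G" "D ** D' = mat 1" using inverse[OF D(1)] by blast
  define a d b where "a = D$1$1" and "d = D$2$2" and "b = D$1$2"
  have ad: "a * d = 1" using diag[OF D(1)] by (simp add: a_def d_def)
  have d1: "\<bar>d\<bar> > 1" using D by (simp add: d_def)
  have a1: "\<bar>a\<bar> < 1"
  proof -
    have "\<bar>a\<bar> * \<bar>d\<bar> = 1" using ad by (metis abs_mult abs_one)
    thus ?thesis using d1 by (metis abs_ge_zero less_le_not_le linorder_not_le mult.commute mult_le_cancel_left1 mult_less_cancel_right1 order_less_trans zero_less_one)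
  qed
  have D'_nth: "D'$1$1 = d" "D'$1$2 = - b" "D'$2$1 = 0" "D'$2$2 = a"
  proof -
    have eqs: "a * D'$1$1 = 1" "a * D'$1$2 + b * D'$2$2 = 0" "d * D'$2$2 = 1"
      using D'(2) tri[OF D(1)] tri[OF D'(1)]
      by (simp_all add: mat2_eq_iff mat2_mult_nth a_def b_def d_def)
    show "D'$2$1 = 0" using tri[OF D'(1)] .
    show "D'$1$1 = d" using eqs(1) ad by (metis mult.commute mult.left_neutral mult.assoc)
    show D22: "D'$2$2 = a" using eqs(3) ad by (metis mult.commute mult.left_neutral mult.assoc)
    have "a * (D'$1$2 + b) = 0" using eqs(2) unfolding D22 by (simp add: algebra_simps)
    thus "D'$1$2 = - b" using ad by auto
  qed
  have translation: "t = 0"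
    if T: "T \<in> G" "T$1$1 = 1" "T$1$2 = t" "T$2$1 = 0" "T$2$2 = 1" for T t
  proof -
    \<comment> \<open>Each conjugation by \<open>D\<close> multiplies the translation length by
      \<open>a / d\<close>, which is the square of \<open>a\<close> since
      \<open>a * d = 1\<close>.\<close>
    define S where "S n = ((\<lambda>A. D ** A ** D') ^^ n) T" for n :: nat
    have S: "S n \<in> G \<and> S n$1$1 = 1 \<and> S n$1$2 = a^(2*n) * t \<and> S n$2$1 = 0 \<and> S n$2$2 = 1" for n
    proof (induction n)
      case 0
      then show ?case using T by (simp add: S_def)
    next
      case (Suc n)
      have S_Suc: "S (Suc n) = D ** S n ** D'" by (simp add: S_def)
      have "D$2$1 = 0" using tri[OF D(1)] .
      then show ?case
        unfolding S_Suc using Suc D(1) D'(1) mult ad D'_nth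
        by (simp add: mat2_mult_nth algebra_simps power2_eq_square flip: a_def b_def d_def)
    qed
    have "(\<lambda>n. (a\<^sup>2)^n * t) \<longlonglongrightarrow> 0"
      by (rule LIMSEQ_power_zero[THEN tendsto_mult_left_zero]) (use a1 in \<open>simp add: abs_square_less_1\<close>)
    hence a0: "(\<lambda>n. a^(2*n) * t) \<longlonglongrightarrow> 0" by (simp add: power_mult)
    have "S \<longlonglongrightarrow> mat 1"
    proof (intro vec_tendstoI)
      fix i j :: 2
      show "(\<lambda>n. S n $ i $ j) \<longlonglongrightarrow> mat 1 $ i $ j"
        using exhaust_2[of i] exhaust_2[of j] S a0 by auto
    qed
    with S obtain n where "S n = mat 1 \<or> S n = - mat 1" using discrete[of S] by blast
    hence "a^(2*n) * t = 0" using S[of n] by (auto simp: mat2_eq_iff)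
    thus ?thesis using ad by auto
  qed
  \<comment> \<open>The finite fixed point of \<open>D\<close>. The relation \<open>comm\<close>
    says that every \<open>B\<close> fixes it, which comes from the commutator of \<open>B\<close>
    and \<open>D\<close> being a trivial translation.\<close>
  define s where "s = b / (d - a)"
  have da: "d - a \<noteq> 0" using a1 d1 by auto
  have comm: "B$1$2 = s * (B$2$2 - B$1$1)" if B: "B \<in> G" for B
  proof -
    obtain B' where B': "B' \<in> G" "B ** B' = mat 1" using inverse[OF B] by blast
    define \<alpha> \<beta> \<delta> where "\<alpha> = B$1$1" and "\<beta> = B$1$2" and "\<delta> = B$2$2"
    have \<alpha>\<delta>: "\<alpha> * \<delta> = 1" using diag[OF B] by (simp add: \<alpha>_def \<delta>_def)
    define T where "T = B ** D ** B' ** D'"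
    have "T \<in> G" unfolding T_def by (intro mult B D B' D')
    have "B' ** B = mat 1" "D' ** D = mat 1"
      using B' D' matrix_inverse_commutes by blast+
    hence TDB: "T ** (D ** B) = B ** D"
      unfolding T_def by (metis matrix_mul_assoc matrix_mul_rid)
    have D21: "D$2$1 = 0" "B$2$1 = 0" "T$2$1 = 0" using tri D(1) B \<open>T \<in> G\<close> by auto
    have eqs: "T$1$1 * (a * \<alpha>) = \<alpha> * a"
      "T$1$1 * (a * \<beta> + b * \<delta>) + T$1$2 * (d * \<delta>) = \<alpha> * b + \<beta> * d"
      "T$2$2 * (d * \<delta>) = \<delta> * d"
      using TDB D21 unfolding mat2_eq_iff mat2_mult_nth a_def b_def d_def \<alpha>_def \<beta>_def \<delta>_def
      by simp_all
    have nz: "a \<noteq> 0" "d \<noteq> 0" "\<alpha> \<noteq> 0" "\<delta> \<noteq> 0" using ad \<alpha>\<delta> by auto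
    have T1: "T$1$1 = 1" "T$2$2 = 1" using eqs(1,3) nz by auto
    have "T$1$2 = 0" by (rule translation[OF \<open>T \<in> G\<close> T1(1) refl D21(3) T1(2)])
    with eqs(2) T1 have "\<beta> * (d - a) = b * (\<delta> - \<alpha>)" by (simp add: algebra_simps)
    thus ?thesis using da by (simp add: s_def \<beta>_def \<alpha>_def \<delta>_def field_simps)
  qed
  \<comment> \<open>The interval starts at \<open>- s\<close>, so the limit point \<open>- t\<close>
    differs from the common fixed point \<open>s\<close>. Since \<open>comm\<close> is linear, it
    passes to \<open>M\<close> and contradicts this.\<close>
  obtain t M where t: "- s < t" "asymptotic G M"
    and M: "M$1$1 = - t * M$2$1" "M$1$2 = - t * M$2$2"
    using ex_asymptotic[OF less_add_one[of "- s"]] by blast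
  then obtain A r where A: "M \<noteq> 0" "\<And>n. A n \<in> G" "filterlim r at_top sequentially"
    "\<And>i j. (\<lambda>n. A n $ i $ j / r n) \<longlonglongrightarrow> M $ i $ j" "\<And>n. r n > 0"
    by (elim asymptoticE) blast
  have M21: "M$2$1 = 0"
    using A(4)[of 2 1] tri[OF A(2)] by (simp add: LIMSEQ_const_iff)
  have "(\<lambda>n. s * (A n$2$2 / r n - A n$1$1 / r n)) \<longlonglongrightarrow> s * (M$2$2 - M$1$1)"
    by (intro tendsto_intros A(4))
  hence "(\<lambda>n. A n$1$2 / r n) \<longlonglongrightarrow> s * (M$2$2 - M$1$1)"
    unfolding comm[OF A(2)] by (simp add: diff_divide_distrib right_diff_distrib)
  hence "M$1$2 = s * (M$2$2 - M$1$1)" using A(4) LIMSEQ_unique by blast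
  hence "(s + t) * M$2$2 = 0" using M M21 by (simp add: algebra_simps)
  hence "M$2$2 = 0" using t(1) by auto
  thus False using A(1) M M21 by (auto simp: mat2_eq_iff)
qed

text \<open>The group fixes no point of the real projective line. \<open>Q\<close> has first column
  (p, q), so conjugation moves that direction to infinity, where
  \<open>ex_not_upper_triangular\<close> applies; dividing by \<open>n\<close> gives determinant
  1.\<close>

lemma ex_moves_direction:
  assumes "p \<noteq> 0 \<or> q \<noteq> 0"
  shows "\<exists>A\<in>G. (A$1$1 * p + A$1$2 * q) * q \<noteq> (A$2$1 * p + A$2$2 * q) * p"
proof -
  define n where "n = p * p + q * q"
  have n: "n \<noteq> 0" using assms by (auto simp: n_def add_nonneg_eq_0_iff)
  obtain P :: "real^2^2" where P: "P$1$1 = p / n" "P$1$2 = q / n" "P$2$1 = - q" "P$2$2 = p"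
    using ex_mat2 by metis
  obtain Q :: "real^2^2" where Q: "Q$1$1 = p" "Q$1$2 = - q / n" "Q$2$1 = q" "Q$2$2 = p / n"
    using ex_mat2 by metis
  have n1: "p * p / n + q * q / n = 1" using n by (simp add: n_def flip: add_divide_distrib)
  have PQ: "P ** Q = mat 1"
    using n1 by (simp add: mat2_eq_iff mat2_mult_nth P Q algebra_simps)
  have "det P = 1" using n1 by (simp add: det_2 P algebra_simps)
  interpret C: first_kind_matrix_group "(\<lambda>A. P ** A ** Q) ` G" by (rule conjugate) fact+
  obtain A where A: "A \<in> G" "(P ** A ** Q)$2$1 \<noteq> 0" using C.ex_not_upper_triangular by blast
  have "(P ** A ** Q)$2$1 = (A$2$1 * p + A$2$2 * q) * p - (A$1$1 * p + A$1$2 * q) * q"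
    by (simp add: mat2_mult_nth P Q algebra_simps)
  with A show ?thesis by (intro bexI[of _ A]) auto
qed

text \<open>Rescaled elements that converge to a matrix of nonzero trace are eventually hyperbolic.
  If the rank one limit \<open>M\<close> is nilpotent, then \<open>M ** B\<close> has nonzero trace as soon as \<open>B\<close> moves
  the image of \<open>M\<close>.\<close>

lemma ex_hyperbolic: "\<exists>A\<in>G. \<bar>A$1$1 + A$2$2\<bar> > 2"
proof -
  have *: ?thesis if "asymptotic G M" "M$1$1 + M$2$2 \<noteq> 0" for M
  proof -
    obtain A r where A: "\<And>n. A n \<in> G" "filterlim r at_top sequentially"
      "\<And>i j. (\<lambda>n. A n $ i $ j / r n) \<longlonglongrightarrow> M $ i $ j" "\<And>n. r n > 0"
      using \<open>asymptotic G M\<close> by (elim asymptoticE) blast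
    have "(\<lambda>n. \<bar>A n$1$1 / r n + A n$2$2 / r n\<bar>) \<longlonglongrightarrow> \<bar>M$1$1 + M$2$2\<bar>"
      by (intro tendsto_intros A(3))
    hence "filterlim (\<lambda>n. \<bar>A n$1$1 / r n + A n$2$2 / r n\<bar> * r n) at_top sequentially"
      by (rule filterlim_tendsto_pos_mult_at_top) (use that A(2) in auto)
    hence "eventually (\<lambda>n. 2 < \<bar>A n$1$1 / r n + A n$2$2 / r n\<bar> * r n) sequentially"
      by (simp add: filterlim_at_top_dense)
    then obtain n where "2 < \<bar>A n$1$1 / r n + A n$2$2 / r n\<bar> * r n"
      by (auto simp: eventually_sequentially)
    hence "2 < \<bar>A n$1$1 + A n$2$2\<bar>"
      using A(4)[of n] by (simp add: abs_divide flip: add_divide_distrib)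
    thus ?thesis using A(1) by blast
  qed
  obtain t M where M: "asymptotic G M" "M$1$1 = - t * M$2$1" "M$1$2 = - t * M$2$2"
    using ex_asymptotic[OF zero_less_one] by blast
  show ?thesis
  proof (cases "M$1$1 + M$2$2 = 0")
    case False
    then show ?thesis using * M by blast
  next
    case True
    hence M22: "M$2$2 = t * M$2$1" using M by simp
    have M21: "M$2$1 \<noteq> 0"
    proof
      assume "M$2$1 = 0"
      hence "M = 0" using M M22 by (simp add: mat2_eq_iff)
      thus False using M(1) by (simp add: asymptotic_def)
    qed
    obtain B where B: "B \<in> G" "(B$1$1 * (-t) + B$1$2 * 1) * 1 \<noteq> (B$2$1 * (-t) + B$2$2 * 1) * (-t)"
      using ex_moves_direction[of "-t" 1] by auto
    \<comment> \<open>Here \<open>M\<close> is \<open>M$2$1\<close> times the column (-t, 1) times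
      the row (1, t). The trace of \<open>M ** B\<close> is therefore \<open>M$2$1\<close> times the
      row (1, t) applied to the image of (-t, 1) under \<open>B\<close>.\<close>
    have "(M ** B)$1$1 + (M ** B)$2$2 = M$2$1 *
        ((B$1$1 * (-t) + B$1$2 * 1) * 1 - (B$2$1 * (-t) + B$2$2 * 1) * (-t))"
      by (simp add: mat2_mult_nth M M22 algebra_simps)
    hence tr: "(M ** B)$1$1 + (M ** B)$2$2 \<noteq> 0" using M21 B(2) by auto
    hence "M ** B \<noteq> 0" by auto
    hence "asymptotic G (M ** B)" using asymptotic_mult_right M(1) B(1) mult by blast
    thus ?thesis using * tr by blast
  qed
qed

text \<open>The image of infinity under \<open>A n\<close> is the slope of its first column, which
  tends to \<open>- t\<close> unless the first column of \<open>M\<close> vanishes. In that case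
  infinity is the kernel of \<open>M\<close>, and a \<open>B\<close> moving infinity is multiplied
  on the right.\<close>

lemma orbit_infinity_dense:
  assumes "a < b"
  shows "\<exists>A\<in>G. A$2$1 \<noteq> 0 \<and> A$1$1 / A$2$1 \<in> {a<..<b}"
proof -
  obtain t M where t: "-b < t" "t < -a"
    and M: "asymptotic G M" "M$1$1 = - t * M$2$1" "M$1$2 = - t * M$2$2"
    using assms by (metis ex_asymptotic neg_less_iff_less)
  have *: ?thesis if N: "asymptotic G N" "N$1$1 = - t * N$2$1" "N$2$1 \<noteq> 0" for N
  proof -
    obtain A r where A: "\<And>n. A n \<in> G"
      "\<And>i j. (\<lambda>n. A n $ i $ j / r n) \<longlonglongrightarrow> N $ i $ j" "\<And>n. r n > 0"
      using N(1) by (elim asymptoticE) blast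
    have "(\<lambda>n. (A n$1$1 / r n) / (A n$2$1 / r n)) \<longlonglongrightarrow> N$1$1 / N$2$1"
      by (intro tendsto_intros A(2) N(3))
    moreover have "(A n$1$1 / r n) / (A n$2$1 / r n) = A n$1$1 / A n$2$1" for n
      using A(3)[of n] by simp
    moreover have "N$1$1 / N$2$1 = - t" using N by simp
    ultimately have "(\<lambda>n. A n$1$1 / A n$2$1) \<longlonglongrightarrow> - t" by (simp only:)
    moreover have "open {a<..<b}" "- t \<in> {a<..<b}" using t by auto
    ultimately have "eventually (\<lambda>n. A n$1$1 / A n$2$1 \<in> {a<..<b}) sequentially"
      using topological_tendstoD by blast
    moreover have "eventually (\<lambda>n. A n$2$1 / r n \<noteq> 0) sequentially"
      using tendsto_imp_eventually_ne[OF A(2) N(3)] .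
    ultimately have "eventually (\<lambda>n. A n$1$1 / A n$2$1 \<in> {a<..<b} \<and> A n$2$1 / r n \<noteq> 0) sequentially"
      by (rule eventually_conj)
    then obtain n where "A n$1$1 / A n$2$1 \<in> {a<..<b}" "A n$2$1 / r n \<noteq> 0"
      unfolding eventually_sequentially by blast
    thus ?thesis using A(1) by (intro bexI[of _ "A n"]) auto
  qed
  show ?thesis
  proof (cases "M$2$1 = 0")
    case False
    then show ?thesis using * M by blast
  next
    case True
    hence "M$2$2 \<noteq> 0" using M by (auto simp: mat2_eq_iff asymptotic_def)
    obtain B where B: "B \<in> G" "B$2$1 \<noteq> 0" using ex_not_upper_triangular by blast
    have "(M ** B)$2$1 \<noteq> 0" "(M ** B)$1$1 = - t * (M ** B)$2$1"
      using True M B \<open>M$2$2 \<noteq> 0\<close> by (simp_all add: mat2_mult_nth)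
    moreover from this have "M ** B \<noteq> 0" by auto
    hence "asymptotic G (M ** B)" using asymptotic_mult_right M(1) B(1) mult by blast
    ultimately show ?thesis using * by blast
  qed
qed

text \<open>The two products vanish exactly when infinity and 0 are sent into the set of these two
  points. Being homogeneous, the relations would pass to \<open>M\<close>; but its columns are
  multiples of (-t, 1) with \<open>t\<close> nonzero, so \<open>M\<close> would be 0.\<close>

lemma ex_not_preserving_axis: "\<exists>A\<in>G. A$1$1 * A$2$1 \<noteq> 0 \<or> A$1$2 * A$2$2 \<noteq> 0"
proof (rule ccontr)
  assume "\<not> ?thesis"
  hence 0: "A$1$1 * A$2$1 = 0" "A$1$2 * A$2$2 = 0" if "A \<in> G" for A using that by blast+
  obtain t M where t: "0 < t" "asymptotic G M"
    and M: "M$1$1 = - t * M$2$1" "M$1$2 = - t * M$2$2"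
    using ex_asymptotic[OF zero_less_one] by blast
  then obtain A r where A: "M \<noteq> 0" "\<And>n. A n \<in> G"
    "\<And>i j. (\<lambda>n. A n $ i $ j / r n) \<longlonglongrightarrow> M $ i $ j"
    by (elim asymptoticE) blast
  have "M$1$j * M$2$j = 0" if "j = 1 \<or> j = 2" for j
  proof -
    have "(\<lambda>n. (A n $ 1 $ j / r n) * (A n $ 2 $ j / r n)) \<longlonglongrightarrow> M$1$j * M$2$j"
      by (intro tendsto_intros A(3))
    moreover have "(A n $ 1 $ j / r n) * (A n $ 2 $ j / r n) = 0" for n
      using 0[OF A(2)[of n]] that by auto
    ultimately show ?thesis by (simp only: LIMSEQ_const_iff)
  qed
  from this[of 1] this[of 2] have "M = 0" using t M by (auto simp: mat2_eq_iff)
  with A(1) show False by simp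
qed

end

section \<open>Equivariant functions\<close>

lemma diagonalize_eigenvectors:
  fixes A :: "real^2^2"
  assumes u: "A$1$1 * u1 + A$1$2 * u2 = p * u1" "A$2$1 * u1 + A$2$2 * u2 = p * u2"
    and v: "A$1$1 * v1 + A$1$2 * v2 = q * v1" "A$2$1 * v1 + A$2$2 * v2 = q * v2"
    and D: "u1 * v2 - u2 * v1 \<noteq> 0"
  obtains P Q :: "real^2^2" where "P ** Q = mat 1" "det P = 1"
    "(P ** A ** Q)$1$1 = p" "(P ** A ** Q)$1$2 = 0" "(P ** A ** Q)$2$1 = 0" "(P ** A ** Q)$2$2 = q"
proof -
  define d where "d = u1 * v2 - u2 * v1"
  have d: "d \<noteq> 0" using D by (simp add: d_def)
  obtain P :: "real^2^2" where P: "P$1$1 = v2 / d" "P$1$2 = - v1 / d" "P$2$1 = - u2" "P$2$2 = u1"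
    using ex_mat2 by metis
  \<comment> \<open>The eigenvectors are the columns; the second is divided by \<open>d\<close> to
    give determinant 1.\<close>
  obtain Q :: "real^2^2" where Q: "Q$1$1 = u1" "Q$1$2 = v1 / d" "Q$2$1 = u2" "Q$2$2 = v2 / d"
    using ex_mat2 by metis
  obtain E :: "real^2^2" where E: "E$1$1 = p" "E$1$2 = 0" "E$2$1 = 0" "E$2$2 = q"
    using ex_mat2 by metis
  have d1: "u1 * v2 / d - u2 * v1 / d = 1" using d by (simp add: d_def flip: diff_divide_distrib)
  have PQ: "P ** Q = mat 1"
    using d1 by (simp add: mat2_eq_iff mat2_mult_nth P Q algebra_simps)
  have "det P = 1" using d1 by (simp add: det_2 P algebra_simps)
  have "A ** Q = Q ** E"
    using u v d by (simp add: mat2_eq_iff mat2_mult_nth Q E mult.commute flip: add_divide_distrib)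
  hence "P ** A ** Q = E"
    by (metis PQ matrix_mul_assoc matrix_mul_lid)
  thus ?thesis using that PQ \<open>det P = 1\<close> E by blast
qed

lemma diagonalize_hyperbolic:
  fixes A :: "real^2^2"
  assumes "det A = 1" and "\<bar>A$1$1 + A$2$2\<bar> > 2"
  obtains P Q p q where "P ** Q = mat 1" "det P = 1" "p * q = 1" "p \<noteq> q"
    "(P ** A ** Q)$1$1 = p" "(P ** A ** Q)$1$2 = 0" "(P ** A ** Q)$2$1 = 0" "(P ** A ** Q)$2$2 = q"
proof -
  define a b c d where abcd: "a = A$1$1" "b = A$1$2" "c = A$2$1" "d = A$2$2"
  have det: "a * d - b * c = 1" using assms(1) by (simp add: det_2 abcd)
  define s where "s = sqrt ((a + d)\<^sup>2 - 4)"
  have "(a + d)\<^sup>2 > 2\<^sup>2" using assms(2) unfolding abcd by (metis abs_le_square_iff abs_numeral linorder_not_le)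
  hence s: "s > 0" "s\<^sup>2 = (a + d)\<^sup>2 - 4" by (auto simp: s_def)
  define p q where "p = (a + d + s) / 2" and "q = (a + d - s) / 2"
  have pq: "p * q = 1" "p + q = a + d" "p \<noteq> q"
    using s by (simp_all add: p_def q_def field_simps power2_eq_square)
  have char: "(p - a) * (p - d) = b * c" "(q - a) * (q - d) = b * c"
    using pq det by algebra+
  \<comment> \<open>By \<open>char\<close>, (b, p - a) and (p - d, c) are eigenvectors for
    \<open>p\<close>, and likewise for \<open>q\<close>. Which pair is independent depends on the
    nonzero off-diagonal entry.\<close>
  consider "b \<noteq> 0" | "c \<noteq> 0" | "b = 0" "c = 0" by blast
  thus ?thesis
  proof cases
    case 1
    have "b * (q - a) - (p - a) * b \<noteq> 0" using 1 pq(3) by (simp add: algebra_simps)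
    from diagonalize_eigenvectors[of A b "p - a" p b "q - a" q, OF _ _ _ _ this] char that[OF _ _ pq(1,3)]
    show ?thesis by (auto simp: abcd[symmetric] algebra_simps)
  next
    case 2
    have "(p - d) * c - c * (q - d) \<noteq> 0" using 2 pq(3) by (simp add: algebra_simps)
    from diagonalize_eigenvectors[of A "p - d" c p "q - d" c q, OF _ _ _ _ this] char that[OF _ _ pq(1,3)]
    show ?thesis by (auto simp: abcd[symmetric] algebra_simps)
  next
    case 3
    have "a \<noteq> d"
    proof
      assume "a = d"
      with 3 det have "\<bar>a\<bar> = 1" by (simp add: abs_if) (auto simp: square_eq_1_iff)
      with \<open>a = d\<close> assms(2) show False by (simp add: abcd)
    qed
    thus ?thesis using 3 det that[of "mat 1" "mat 1" a d] by (simp add: abcd)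
  qed
qed

context first_kind_matrix_group
begin

lemma equivariant_nonreal_imp_id:
  assumes hol: "h holomorphic_on {z. 0 < Im z}"
    and nonreal: "\<And>z. 0 < Im z \<Longrightarrow> Im (h z) \<noteq> 0"
    and equi: "\<And>A z. A \<in> G \<Longrightarrow> 0 < Im z \<Longrightarrow> h (mob A z) = mob A (h z)"
    and z: "0 < Im z"
  shows "h z = z"
proof -
  obtain A where A: "A \<in> G" "\<bar>A$1$1 + A$2$2\<bar> > 2" using ex_hyperbolic by blast
  obtain P Q p q where PQ: "P ** Q = mat 1" "det P = 1" and pq: "p * q = 1" "p \<noteq> q"
    and E: "(P ** A ** Q)$1$1 = p" "(P ** A ** Q)$1$2 = 0" "(P ** A ** Q)$2$1 = 0" "(P ** A ** Q)$2$2 = q"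
    using diagonalize_hyperbolic[OF det[OF A(1)] A(2)] by metis
  have QP: "Q ** P = mat 1" by (rule matrix_inverse_commutes[OF PQ(1)])
  have detQ: "det Q = 1" by (rule det_of_inverse[OF PQ])
  interpret C: first_kind_matrix_group "(\<lambda>A. P ** A ** Q) ` G" by (rule conjugate) fact+
  define g where "g z = mob P (h (mob Q z))" for z
  have ImQ: "0 < Im (mob Q z)" if "0 < Im z" for z
    using Im_mob_pos_iff[OF detQ, of z] that by simp
  have g_nonreal: "Im (g z) \<noteq> 0" if "0 < Im z" for z
    unfolding g_def by (intro Im_mob_nonzero PQ nonreal ImQ that)
  have "(h \<circ> mob Q) holomorphic_on {z. 0 < Im z}"
    by (rule holomorphic_on_compose_gen[OF holomorphic_on_mob[OF detQ] hol]) (use ImQ in auto)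
  hence "(mob P \<circ> (h \<circ> mob Q)) holomorphic_on {z. 0 < Im z}"
    by (rule holomorphic_on_compose_gen[OF _ holomorphic_on_mob[OF PQ(2), of "{z. Im z \<noteq> 0}"]])
       (use nonreal ImQ in auto)
  hence g_hol: "g holomorphic_on {z. 0 < Im z}"
    by (simp add: comp_def g_def[abs_def])
  have g_equi: "g (mob B z) = mob B (g z)" if B: "B \<in> (\<lambda>A. P ** A ** Q) ` G" and z: "0 < Im z" for B z
  proof -
    obtain A' where A': "A' \<in> G" "B = P ** A' ** Q" using B by blast
    note nz = ImQ[OF z] nonreal[OF ImQ[OF z]]
    have "Q ** B = A' ** Q" unfolding A'(2) by (metis QP matrix_mul_assoc matrix_mul_lid)
    hence "mob Q (mob B z) = mob A' (mob Q z)"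
      using mob_mult[of B z Q] mob_mult[of Q z A'] C.det[OF B] detQ z by simp
    hence "g (mob B z) = mob (P ** A') (h (mob Q z))"
      unfolding g_def using equi[OF A'(1) nz(1)] mob_mult[OF det[OF A'(1)] nz(2)] by simp
    also have "P ** A' = B ** P" unfolding A'(2) by (metis QP matrix_mul_assoc matrix_mul_rid)
    also have "mob (B ** P) (h (mob Q z)) = mob B (g z)"
      unfolding g_def by (rule mob_mult[OF PQ(2) nz(2)])
    finally show ?thesis .
  qed
  \<comment> \<open>Since \<open>p * q = 1\<close>, this is the square of \<open>p\<close>, hence
    positive even if the eigenvalues are negative.\<close>
  define k where "k = p / q"
  have q0: "q \<noteq> 0" using pq by auto
  have "k = p\<^sup>2" using pq q0 by (simp add: k_def power2_eq_square field_simps)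
  hence k: "0 < k" "k \<noteq> 1" using pq q0 by (auto simp: k_def)
  have mobE: "mob (P ** A ** Q) z = of_real k * z" for z
    unfolding mob_def E k_def by simp
  have scaling: "g (of_real k * z) = of_real k * g z" if "0 < Im z" for z
    using g_equi[OF imageI[OF A(1)] that] unfolding mobE .
  obtain c where c: "c \<noteq> 0" "\<And>z. 0 < Im z \<Longrightarrow> g z = of_real c * z"
    using scaling_equivariant_nonreal[OF g_hol g_nonreal k scaling] by metis
  have "c = 1"
  proof (rule ccontr)
    assume "c \<noteq> 1"
    obtain B where B: "B \<in> (\<lambda>A. P ** A ** Q) ` G" "B$1$1 * B$2$1 \<noteq> 0 \<or> B$1$2 * B$2$2 \<noteq> 0"
      using C.ex_not_preserving_axis by blast
    \<comment> \<open>On the imaginary axis, the real part of the cleared equation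
      \<open>c * B z = B (c * z)\<close> splits off the factor \<open>c - 1\<close>. Two values of
      \<open>y\<close> then make both coefficients vanish.\<close>
    have eq: "(c * B$1$1 * B$2$1) * y\<^sup>2 = B$1$2 * B$2$2" if y: "0 < y" for y :: real
    proof -
      let ?z = "of_real y * \<i>"
      have Im: "0 < Im ?z" using y by simp
      have "0 < Im (mob B ?z)" using Im_mob_pos_iff[OF C.det[OF B(1)], of ?z] Im by simp
      hence "of_real c * mob B ?z = mob B (of_real c * ?z)"
        using g_equi[OF B(1) Im] c(2) Im by simp
      moreover have "of_real (B$2$1) * ?z + of_real (B$2$2) \<noteq> 0"
        "of_real (B$2$1) * (of_real c * ?z) + of_real (B$2$2) \<noteq> 0"
        by (rule mob_denom_nonzero[OF C.det[OF B(1)]]; use y c in simp)+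
      ultimately have "of_real c * (of_real (B$1$1) * ?z + of_real (B$1$2)) *
          (of_real (B$2$1) * (of_real c * ?z) + of_real (B$2$2)) =
        (of_real (B$1$1) * (of_real c * ?z) + of_real (B$1$2)) *
          (of_real (B$2$1) * ?z + of_real (B$2$2))"
        unfolding mob_def by (simp add: frac_eq_eq)
      hence "Re (of_real c * (of_real (B$1$1) * ?z + of_real (B$1$2)) *
          (of_real (B$2$1) * (of_real c * ?z) + of_real (B$2$2))) =
        Re ((of_real (B$1$1) * (of_real c * ?z) + of_real (B$1$2)) *
          (of_real (B$2$1) * ?z + of_real (B$2$2)))" by simp
      hence "(c - 1) * ((c * B$1$1 * B$2$1) * y\<^sup>2 - B$1$2 * B$2$2) = 0"
        by (simp add: algebra_simps power2_eq_square)
      thus ?thesis using \<open>c \<noteq> 1\<close> by simp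
    qed
    from eq[of 1] eq[of 2] have "c * B$1$1 * B$2$1 = 0" "B$1$2 * B$2$2 = 0" by simp_all
    with B(2) c(1) show False by auto
  qed
  have ImP: "0 < Im (mob P z)" using Im_mob_pos_iff[OF PQ(2), of z] z by simp
  have QPz: "mob Q (mob P w) = w" if "Im w \<noteq> 0" for w
    using mob_mult[OF PQ(2) that, of Q] by (simp add: QP)
  have "mob P (h z) = mob P z"
    using c(2)[OF ImP] QPz[of z] z by (simp add: \<open>c = 1\<close> g_def)
  hence "mob Q (mob P (h z)) = mob Q (mob P z)" by simp
  thus ?thesis using QPz[of z] QPz[of "h z"] z nonreal[OF z] by simp
qed

text \<open>A real value would, by the open mapping theorem, force a value in the dense orbit of
  infinity, and then equivariance a pole.\<close>

lemma equivariant_nonreal: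
  assumes hol: "h holomorphic_on {z. 0 < Im z}"
    and equi: "\<And>A z. A \<in> G \<Longrightarrow> 0 < Im z \<Longrightarrow> moebius A (Some (h z)) = Some (h (mob A z))"
    and z: "0 < Im z"
  shows "Im (h z) \<noteq> 0"
proof
  let ?H = "{z. 0 < Im z}"
  assume "Im (h z) = 0"
  then obtain x :: real where x: "h z = of_real x" using complex_is_Real_iff Reals_cases by metis
  have denom: "of_real (A$2$1) * h w + of_real (A$2$2) \<noteq> 0" if "A \<in> G" "0 < Im w" for A w
    using equi[OF that] by (auto simp: moebius_def split: if_splits)
  show False
  \<comment> \<open>The open mapping theorem does not cover constants; a real constant would be a
    point fixed by the whole group.\<close>
  proof (cases "h constant_on ?H")
    case True
    hence const: "h w = of_real x" if "0 < Im w" for w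
      using that z x unfolding constant_on_def by (metis mem_Collect_eq)
    obtain A where A: "A \<in> G" "(A$1$1 * x + A$1$2 * 1) * 1 \<noteq> (A$2$1 * x + A$2$2 * 1) * x"
      using ex_moves_direction[of x 1] by auto
    have "Im (mob A z) > 0" using Im_mob_pos_iff[OF det[OF A(1)], of z] z by simp
    hence "moebius A (Some (of_real x)) = Some (of_real x)"
      using equi[OF A(1) z] const z by simp
    hence "(of_real (A$1$1) * of_real x + of_real (A$1$2)) / (of_real (A$2$1) * of_real x + of_real (A$2$2)) = complex_of_real x"
      by (simp add: moebius_def split: if_splits)
    hence "complex_of_real ((A$1$1 * x + A$1$2) / (A$2$1 * x + A$2$2)) = of_real x"
      by simp
    hence "(A$1$1 * x + A$1$2) / (A$2$1 * x + A$2$2) = x" unfolding of_real_eq_iff .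
    moreover have "complex_of_real (A$2$1 * x + A$2$2) \<noteq> 0" using denom[OF A(1) z] x by simp
    hence "A$2$1 * x + A$2$2 \<noteq> 0" by (metis of_real_0)
    ultimately show False using A(2) by (simp add: field_simps)
  next
    case False
    have "open (h ` ?H)"
      by (rule open_mapping_thm[OF hol]) (use False in \<open>auto simp: open_halfspace_Im_gt convex_connected convex_halfspace_Im_gt\<close>)
    moreover have "of_real x \<in> h ` ?H" using x z by force
    ultimately obtain e where e: "e > 0" "ball (of_real x) e \<subseteq> h ` ?H"
      by (meson openE)
    obtain A where A: "A \<in> G" "A$2$1 \<noteq> 0" "A$1$1 / A$2$1 \<in> {x<..<x + e}"
      using orbit_infinity_dense[of x "x + e"] e(1) by auto
    have "dist x (A$1$1 / A$2$1) < e" using A(3) by (auto simp: dist_real_def)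
    hence "complex_of_real (A$1$1 / A$2$1) \<in> ball (of_real x) e" by (simp add: dist_of_real del: of_real_divide)
    hence "complex_of_real (A$1$1 / A$2$1) \<in> h ` ?H" by (rule subsetD[OF e(2)])
    then obtain w where "of_real (A$1$1 / A$2$1) = h w" "w \<in> ?H" by (rule imageE)
    hence w: "0 < Im w" "h w = of_real (A$1$1 / A$2$1)" by simp_all
    \<comment> \<open>The inverse of \<open>A\<close> sends \<open>h w\<close> back to infinity, so
      its denominator vanishes at \<open>h w\<close>.\<close>
    obtain B where B: "B \<in> G" "A ** B = mat 1" using inverse[OF A(1)] by blast
    have "(B ** A)$2$1 = 0" using matrix_inverse_commutes[OF B(2)] by simp
    hence "B$2$1 * (A$1$1 / A$2$1) + B$2$2 = 0"
      using A(2) by (simp add: mat2_mult_nth field_simps)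
    hence "complex_of_real (B$2$1 * (A$1$1 / A$2$1) + B$2$2) = 0" by (simp only: of_real_0)
    with denom[OF B(1) w(1)] show False unfolding w(2) by simp
  qed
qed

end

section \<open>The matrix group of a Fuchsian group\<close>

definition matrices_over :: "(real^2^2) set set \<Rightarrow> (real^2^2) set" where
  "matrices_over \<Gamma> = {A. det A = 1 \<and> pm_id #>\<^bsub>SL2R\<^esub> A \<in> \<Gamma>}"

section \<open>Cosets modulo sign\<close>

lemma coset_mult_PSL2R:
  assumes "det A = 1" "det B = 1"
  shows "(pm_id #>\<^bsub>SL2R\<^esub> A) \<otimes>\<^bsub>PSL2R\<^esub> (pm_id #>\<^bsub>SL2R\<^esub> B) = pm_id #>\<^bsub>SL2R\<^esub> (A ** B)"
  using normal.rcos_sum[OF normal_pm_id, of A B] assms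
  by (simp add: PSL2R_def FactGroup_def carrier_SL2R mult_SL2R)

lemma one_PSL2R: "\<one>\<^bsub>PSL2R\<^esub> = pm_id"
  by (simp add: PSL2R_def FactGroup_def)

lemma coset_one: "pm_id #>\<^bsub>SL2R\<^esub> mat 1 = pm_id"
  by (simp only: coset_SL2R) (simp add: pm_id_def)

lemma psl_act_matrices_over:
  assumes "det A = 1" "0 < Im z"
  shows "psl_act (pm_id #>\<^bsub>SL2R\<^esub> A) (Some z) = Some (mob A z)"
  using moebius_eq_mob[OF assms(1), of z] assms(2) by (simp add: psl_act_coset)

text \<open>Only finite limit points are tested, by images of balls; neighbourhoods of infinity
  never have to be described.\<close>

lemma limit_set_realE:
  assumes "subgroup \<Gamma> PSL2R" and "Some (of_real x) \<in> limit_set \<Gamma>"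
  obtains z A where "0 < Im z" "\<And>n. A n \<in> matrices_over \<Gamma>"
    "\<And>n::nat. dist (mob (A n) z) (of_real x) < 1 / real (Suc n)"
proof -
  obtain z where z: "0 < Im z" and der: "Some (of_real x) \<in> rsphere_topology derived_set_of orbit \<Gamma> z"
    using assms(2) by (auto simp: limit_set_def upper_half_plane_def)
  have "\<exists>A\<in>matrices_over \<Gamma>. dist (mob A z) (of_real x) < e" if "e > 0" for e
  proof -
    have "openin rsphere_topology (Some ` ball (of_real x) e)"
      by (simp add: rsphere_topology_def flip: open_openin)
    moreover have "Some (of_real x) \<in> Some ` ball (complex_of_real x) e" using that by simp
    ultimately obtain y where "y \<in> orbit \<Gamma> z" "y \<in> Some ` ball (of_real x) e"
      using der unfolding in_derived_set_of by blast
    then obtain \<gamma> w where \<gamma>: "\<gamma> \<in> \<Gamma>" "psl_act \<gamma> (Some z) = Some w" "dist (of_real x) w < e"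
      by (auto simp: orbit_def)
    have "\<gamma> \<in> carrier PSL2R" using subgroup.subset[OF assms(1)] \<gamma>(1) by blast
    then obtain A where A: "det A = 1" "\<gamma> = pm_id #>\<^bsub>SL2R\<^esub> A"
      by (auto simp: carrier_PSL2R coset_SL2R)
    have "w = mob A z" using \<gamma>(2) psl_act_matrices_over[OF A(1) z] A(2) by simp
    with A \<gamma> show ?thesis by (intro bexI[of _ A]) (auto simp: matrices_over_def dist_commute)
  qed
  hence "\<exists>A. A \<in> matrices_over \<Gamma> \<and> dist (mob A z) (of_real x) < 1 / real (Suc n)" for n
    by (metis of_nat_0_less_iff zero_less_Suc zero_less_divide_1_iff)
  then obtain A where "\<And>n. A n \<in> matrices_over \<Gamma> \<and> dist (mob (A n) z) (of_real x) < 1 / real (Suc n)"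
    by metis
  thus ?thesis using that z by blast
qed

section \<open>Compactness: from limit points to limits of rescaled matrices\<close>

lemma norm_mat2_le:
  fixes A :: "real^2^2"
  shows "norm A \<le> \<bar>A$1$1\<bar> + \<bar>A$1$2\<bar> + \<bar>A$2$1\<bar> + \<bar>A$2$2\<bar>"
proof -
  have "norm A \<le> norm (A$1) + norm (A$2)"
    using L2_set_le_sum[of UNIV "\<lambda>i. norm (A$i)"] by (simp add: norm_vec_def sum_2)
  moreover have "norm (A$i) \<le> \<bar>A$i$1\<bar> + \<bar>A$i$2\<bar>" for i
    using norm_le_l1_cart[of "A$i"] by (simp add: sum_2)
  from this[of 1] this[of 2] have "norm (A$1) + norm (A$2) \<le> \<bar>A$1$1\<bar> + \<bar>A$1$2\<bar> + \<bar>A$2$1\<bar> + \<bar>A$2$2\<bar>"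
    by linarith
  ultimately show ?thesis by linarith
qed

text \<open>Since 1 and a nonreal \<open>z\<close> are independent over the reals, one value
  controls both coefficients; the imaginary part isolates \<open>a\<close>.\<close>

lemma coeff_bounds:
  assumes "0 < Im z" "norm (of_real a * z + of_real b) \<le> K"
  shows "\<bar>a\<bar> \<le> K / Im z" "\<bar>b\<bar> \<le> K + K / Im z * norm z"
proof -
  have "\<bar>Im (of_real a * z + of_real b)\<bar> \<le> K" using abs_Im_le_cmod assms(2) order_trans by blast
  hence "\<bar>a\<bar> * Im z \<le> K" using assms(1) by (simp add: abs_mult)
  thus a: "\<bar>a\<bar> \<le> K / Im z" using assms(1) by (simp add: field_simps)
  have "norm (complex_of_real b) \<le> norm (of_real a * z + of_real b) + norm (of_real a * z)"
    by (metis add_diff_cancel_left' norm_triangle_ineq4)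
  also have "norm (of_real a * z) \<le> K / Im z * norm z"
    unfolding norm_mult norm_of_real by (intro mult_right_mono a) simp
  finally show "\<bar>b\<bar> \<le> K + K / Im z * norm z" using assms(2) by simp
qed

text \<open>The scale is the modulus of the denominator at \<open>z\<close>. It tends to infinity
  because \<open>Im (mob (A n) z)\<close>, which is \<open>Im z\<close> over its square, tends to 0.
  After rescaling, the second row has modulus 1 at \<open>z\<close> and the first stays bounded, so
  a subsequence converges to a nonzero \<open>M\<close>. In the limit the first row is
  \<open>x\<close> times the second at \<open>z\<close>, hence entrywise.\<close>

lemma asymptotic_of_limit_point:
  assumes z: "0 < Im z" and A: "\<And>n. A n \<in> G" "\<And>n. det (A n) = 1"
    and lim: "\<And>n::nat. dist (mob (A n) z) (of_real x) < 1 / real (Suc n)"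
  shows "\<exists>M. asymptotic G M \<and> M$1$1 = x * M$2$1 \<and> M$1$2 = x * M$2$2"
proof -
  define D where "D n = of_real (A n$2$1) * z + of_real (A n$2$2)" for n
  define r where "r n = norm (D n)" for n
  have D: "D n \<noteq> 0" for n
    unfolding D_def using mob_denom_nonzero[OF A(2)] z by simp
  hence r: "r n > 0" for n by (simp add: r_def)
  have num: "of_real (A n$1$1) * z + of_real (A n$1$2) = mob (A n) z * D n" for n
    using D[of n] by (simp add: mob_def D_def)
  have r_ge: "sqrt (Im z * real (Suc n)) \<le> r n" for n
  proof -
    have "Im (mob (A n) z) \<le> dist (mob (A n) z) (of_real x)"
      using abs_Im_le_cmod[of "mob (A n) z - of_real x"] by (simp add: dist_norm)
    also have "\<dots> < 1 / real (Suc n)" by (rule lim)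
    finally have "Im z / (r n)\<^sup>2 < 1 / real (Suc n)" by (simp add: Im_mob[OF A(2)] r_def D_def)
    hence "Im z * real (Suc n) \<le> (r n)\<^sup>2" using r[of n] by (simp add: field_simps)
    thus ?thesis using r[of n] by (simp add: real_le_lsqrt)
  qed
  have "filterlim (\<lambda>n. sqrt (Im z * real (Suc n))) at_top sequentially"
    by (intro filterlim_compose[OF sqrt_at_top] filterlim_tendsto_pos_mult_at_top[OF tendsto_const z]
        filterlim_compose[OF filterlim_real_sequentially filterlim_Suc])
  hence r_top: "filterlim r at_top sequentially"
    by (rule filterlim_at_top_mono) (use r_ge in simp)
  define B where "B n = (1 / r n) *\<^sub>R A n" for n
  have B: "B n$i$j = A n$i$j / r n" for n i j by (simp add: B_def)
  have row2: "of_real (B n$2$1) * z + of_real (B n$2$2) = D n / of_real (r n)" for n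
    by (simp add: B D_def add_divide_distrib)
  have row1: "of_real (B n$1$1) * z + of_real (B n$1$2) = mob (A n) z * (D n / of_real (r n))" for n
    using num[of n] by (simp add: B flip: add_divide_distrib)
  have unit: "norm (D n / of_real (r n)) = 1" for n
    using D[of n] by (simp add: norm_divide r_def)
  have mob_le: "norm (mob (A n) z) \<le> \<bar>x\<bar> + 1" for n
  proof -
    have "norm (mob (A n) z) \<le> norm (complex_of_real x) + dist (mob (A n) z) (of_real x)"
      by (metis add.commute dist_norm norm_triangle_sub)
    moreover have "dist (mob (A n) z) (of_real x) < 1"
      by (rule order_less_le_trans[OF lim]) simp
    ultimately show ?thesis by simp
  qed
  have "bounded (range B)"
  proof -
    define K where "K = \<bar>x\<bar> + 1"
    define L where "L = K / Im z + (K + K / Im z * norm z)"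
    have "norm (of_real (B n$1$1) * z + of_real (B n$1$2)) \<le> K"
      "norm (of_real (B n$2$1) * z + of_real (B n$2$2)) \<le> K" for n
      unfolding row1 row2 norm_mult unit using mob_le[of n] by (simp_all add: K_def)
    from coeff_bounds[OF z this(1)] coeff_bounds[OF z this(2)]
    have "norm (B n) \<le> 2 * L" for n
      using norm_mat2_le[of "B n"] unfolding L_def by (smt (verit))
    thus ?thesis by (intro boundedI) auto
  qed
  then obtain M \<sigma> where \<sigma>: "strict_mono \<sigma>" and M: "(B \<circ> \<sigma>) \<longlonglongrightarrow> M"
    using bounded_imp_convergent_subsequence by blast
  have Mij: "(\<lambda>n. B (\<sigma> n)$i$j) \<longlonglongrightarrow> M$i$j" for i j
    using tendsto_mat2_nth[OF M] by (simp add: comp_def)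
  have lim2: "(\<lambda>n. D (\<sigma> n) / of_real (r (\<sigma> n))) \<longlonglongrightarrow> of_real (M$2$1) * z + of_real (M$2$2)"
    unfolding row2[symmetric] by (intro tendsto_intros Mij)
  have "(\<lambda>n. norm (D (\<sigma> n) / of_real (r (\<sigma> n)))) \<longlonglongrightarrow> norm (of_real (M$2$1) * z + of_real (M$2$2))"
    by (rule tendsto_norm[OF lim2])
  hence "norm (of_real (M$2$1) * z + of_real (M$2$2)) = 1"
    unfolding unit by (simp add: LIMSEQ_const_iff)
  hence "M \<noteq> 0" by auto
  have "(\<lambda>n. mob (A n) z) \<longlonglongrightarrow> of_real x"
    by (rule metric_tendsto_imp_tendsto[OF lim_inverse_n'[THEN LIMSEQ_Suc]])
       (use lim in \<open>auto intro!: always_eventually less_imp_le simp: dist_real_def\<close>)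
  hence "(\<lambda>n. mob (A (\<sigma> n)) z) \<longlonglongrightarrow> of_real x"
    using LIMSEQ_subseq_LIMSEQ[OF _ \<sigma>] by (auto simp: comp_def)
  hence "(\<lambda>n. of_real (B (\<sigma> n)$1$1) * z + of_real (B (\<sigma> n)$1$2)) \<longlonglongrightarrow>
      of_real x * (of_real (M$2$1) * z + of_real (M$2$2))"
    unfolding row1 by (intro tendsto_mult lim2)
  moreover have "(\<lambda>n. of_real (B (\<sigma> n)$1$1) * z + of_real (B (\<sigma> n)$1$2)) \<longlonglongrightarrow>
      of_real (M$1$1) * z + of_real (M$1$2)"
    by (intro tendsto_intros Mij)
  ultimately have eq: "of_real (M$1$1) * z + of_real (M$1$2) =
      of_real x * (of_real (M$2$1) * z + of_real (M$2$2))"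
    by (rule LIMSEQ_unique[rotated])
  from arg_cong[OF eq, of Im] z have M1: "M$1$1 = x * M$2$1" by simp
  from arg_cong[OF eq, of Re] have "M$1$2 = x * M$2$2" by (simp add: M1 algebra_simps)
  moreover have "asymptotic G M"
  proof (rule asymptoticI[OF \<open>M \<noteq> 0\<close>])
    show "A (\<sigma> n) \<in> G" for n by (rule A)
    show "filterlim (\<lambda>n. r (\<sigma> n)) at_top sequentially"
      by (rule filterlim_compose[OF r_top filterlim_subseq[OF \<sigma>]])
    show "(\<lambda>n. (1 / r (\<sigma> n)) *\<^sub>R A (\<sigma> n)) \<longlonglongrightarrow> M"
      using M by (simp add: comp_def B_def)
  qed
  ultimately show ?thesis using M1 by blast
qed

lemma fuchsian_first_kind_matrix_group:
  assumes "fuchsian_group \<Gamma>" "first_kind \<Gamma>"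
  shows "first_kind_matrix_group (matrices_over \<Gamma>)"
proof
  have sub: "subgroup \<Gamma> PSL2R"
    and disc: "subtopology PSL2R_topology \<Gamma> = discrete_topology \<Gamma>"
    using assms(1) by (auto simp: fuchsian_group_def)
  show "det A = 1" if "A \<in> matrices_over \<Gamma>" for A
    using that by (simp add: matrices_over_def)
  show "A ** B \<in> matrices_over \<Gamma>" if "A \<in> matrices_over \<Gamma>" "B \<in> matrices_over \<Gamma>" for A B
    using that subgroup.m_closed[OF sub, of "pm_id #>\<^bsub>SL2R\<^esub> A" "pm_id #>\<^bsub>SL2R\<^esub> B"]
    by (simp add: matrices_over_def det_mul coset_mult_PSL2R)
  show "\<exists>B\<in>matrices_over \<Gamma>. A ** B = mat 1" if A: "A \<in> matrices_over \<Gamma>" for A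
  proof -
    have det: "det A = 1" using A by (simp add: matrices_over_def)
    hence "invertible A" by (simp add: invertible_det_nz)
    then obtain B where B: "A ** B = mat 1" by (auto simp: invertible_def)
    have detB: "det B = 1" by (rule det_of_inverse[OF B det])
    have carrier: "pm_id #>\<^bsub>SL2R\<^esub> C \<in> carrier PSL2R" if "det C = 1" for C
      using that by (auto simp: carrier_PSL2R coset_SL2R)
    have "(pm_id #>\<^bsub>SL2R\<^esub> B) \<otimes>\<^bsub>PSL2R\<^esub> (pm_id #>\<^bsub>SL2R\<^esub> A) = \<one>\<^bsub>PSL2R\<^esub>"
      by (simp add: coset_mult_PSL2R det detB matrix_inverse_commutes[OF B] coset_one one_PSL2R)
    hence "inv\<^bsub>PSL2R\<^esub> (pm_id #>\<^bsub>SL2R\<^esub> A) = pm_id #>\<^bsub>SL2R\<^esub> B"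
      by (rule group.inv_equality[OF group_PSL2R]) (intro carrier det detB)+
    hence "pm_id #>\<^bsub>SL2R\<^esub> B \<in> \<Gamma>"
      using subgroup.m_inv_closed[OF sub, of "pm_id #>\<^bsub>SL2R\<^esub> A"] A by (simp add: matrices_over_def)
    thus ?thesis using B detB by (auto simp: matrices_over_def)
  qed
  show "\<exists>n. f n = mat 1 \<or> f n = - mat 1"
    if f: "\<And>n. f n \<in> matrices_over \<Gamma>" "f \<longlonglongrightarrow> mat 1" for f :: "nat \<Rightarrow> real^2^2"
  proof -
    have "pm_id \<in> \<Gamma>" using subgroup.one_closed[OF sub] by (simp add: one_PSL2R)
    \<comment> \<open>An open set isolating the identity coset in \<open>\<Gamma>\<close> pulls back
      to a neighbourhood of \<open>mat 1\<close> that meets the matrix group only in plus or minus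
      \<open>mat 1\<close>.\<close>
    hence "openin (subtopology PSL2R_topology \<Gamma>) {pm_id}" by (simp add: disc)
    then obtain U where U: "openin PSL2R_topology U" "{pm_id} = U \<inter> \<Gamma>"
      unfolding openin_subtopology by blast
    let ?V = "{A \<in> carrier SL2R. pm_id #>\<^bsub>SL2R\<^esub> A \<in> U}"
    have "openin (top_of_set (carrier SL2R)) ?V" using U(1) by (simp add: openin_PSL2R_topology)
    then obtain W where W: "open W" "?V = carrier SL2R \<inter> W" by (auto simp: openin_open)
    have "mat 1 \<in> ?V" using U(2) by (auto simp: carrier_SL2R coset_one)
    hence "mat 1 \<in> W" using W(2) by blast
    with f(2) W(1) have "eventually (\<lambda>n. f n \<in> W) sequentially" by (rule topological_tendstoD)
    then obtain n where n: "f n \<in> W" by (auto simp: eventually_sequentially)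
    have "f n \<in> carrier SL2R" using f(1)[of n] by (simp add: matrices_over_def carrier_SL2R)
    with n W(2) have "f n \<in> ?V" by blast
    hence "pm_id #>\<^bsub>SL2R\<^esub> f n \<in> U \<inter> \<Gamma>" using f(1)[of n] by (simp add: matrices_over_def)
    hence "pm_id #>\<^bsub>SL2R\<^esub> f n = pm_id" using U(2) by blast
    hence "f n \<in> pm_id" by (auto simp: coset_SL2R)
    thus ?thesis by (auto simp: pm_id_def)
  qed
  \<comment> \<open>The exceptional line is the one belonging to infinity. Any other row
    \<open>l\<close> annihilates the column (x, 1) for the finite point
    \<open>x = - l$2 / l$1\<close>.\<close>
  obtain m :: "real^2" where m: "m$1 = 0" "m$2 = 1"
    using that[of "vector [0, 1]"] by simp
  show "\<exists>m::real^2. m \<noteq> 0 \<and> (\<forall>l. l$1 * m$2 \<noteq> l$2 * m$1 \<longrightarrow>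
      (\<exists>M. asymptotic (matrices_over \<Gamma>) M \<and> l v* M = 0))"
  proof (intro exI[of _ m] conjI allI impI)
    show "m \<noteq> 0" using m by auto
    fix l :: "real^2"
    assume "l$1 * m$2 \<noteq> l$2 * m$1"
    hence l1: "l$1 \<noteq> 0" by (simp add: m)
    define x where "x = - l$2 / l$1"
    have "Some (complex_of_real x) \<in> limit_set \<Gamma>"
      using assms(2) by (auto simp: first_kind_def extended_reals_def)
    then obtain z A where "0 < Im z" "\<And>n. A n \<in> matrices_over \<Gamma>"
      "\<And>n::nat. dist (mob (A n) z) (of_real x) < 1 / real (Suc n)"
      using limit_set_realE[OF sub] by metis
    moreover from this(2) have "det (A n) = 1" for n by (simp add: matrices_over_def)
    ultimately obtain M where M: "asymptotic (matrices_over \<Gamma>) M"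
      "M$1$1 = x * M$2$1" "M$1$2 = x * M$2$2"
      using asymptotic_of_limit_point by metis
    have "l v* M = 0"
      using l1 by (simp add: real2_eq_iff vec_mat2_nth M x_def)
    with M(1) show "\<exists>M. asymptotic (matrices_over \<Gamma>) M \<and> l v* M = 0" by blast
  qed
qed

theorem theorem5p1:
  fixes \<Gamma> :: "(real^2^2) set set"
  assumes "fuchsian_group \<Gamma>" and "first_kind \<Gamma>"
  shows "equivariant_holomorphic \<Gamma> = {\<lambda>z\<in>upper_half_plane. z}"
proof (intro equalityI subsetI)
  interpret first_kind_matrix_group "matrices_over \<Gamma>"
    by (rule fuchsian_first_kind_matrix_group) fact+
  fix h assume "h \<in> equivariant_holomorphic \<Gamma>"
  hence ext: "h \<in> extensional upper_half_plane"
    and hol: "h holomorphic_on {z. 0 < Im z}"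
    and equi: "\<And>\<gamma> z. \<gamma> \<in> \<Gamma> \<Longrightarrow> 0 < Im z \<Longrightarrow> map_option h (psl_act \<gamma> (Some z)) = psl_act \<gamma> (Some (h z))"
    by (auto simp: equivariant_holomorphic_def upper_half_plane_def)
  \<comment> \<open>The action on \<open>h z\<close> has to stay on the sphere until the values of
    \<open>h\<close> are known to be nonreal; only then can \<open>mob\<close> replace it.\<close>
  have moebius: "moebius A (Some (h z)) = Some (h (mob A z))"
    if "A \<in> matrices_over \<Gamma>" "0 < Im z" for A z
    using equi[of "pm_id #>\<^bsub>SL2R\<^esub> A" z] psl_act_matrices_over[OF det[OF that(1)] that(2)] that
    by (simp add: matrices_over_def psl_act_coset)
  have nonreal: "Im (h z) \<noteq> 0" if "0 < Im z" for z
    using equivariant_nonreal[OF hol moebius that] .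
  have "h (mob A z) = mob A (h z)" if "A \<in> matrices_over \<Gamma>" "0 < Im z" for A z
    using moebius[OF that] moebius_eq_mob[OF det[OF that(1)] nonreal[OF that(2)]] by simp
  from equivariant_nonreal_imp_id[OF hol nonreal this]
  have "h z = z" if "z \<in> upper_half_plane" for z using that by (simp add: upper_half_plane_def)
  with ext have "h = (\<lambda>z\<in>upper_half_plane. z)"
    by (intro extensionalityI[OF ext]) auto
  thus "h \<in> {\<lambda>z\<in>upper_half_plane. z}" by simp
next
  fix h assume "h \<in> {\<lambda>z\<in>upper_half_plane. z :: complex}"
  hence h: "h = (\<lambda>z\<in>upper_half_plane. z)" by simp
  have "h holomorphic_on upper_half_plane \<longleftrightarrow> (\<lambda>z. z) holomorphic_on upper_half_plane"
    by (rule holomorphic_cong) (auto simp: h)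
  hence "h holomorphic_on upper_half_plane" by simp
  moreover have "map_option h (psl_act \<gamma> (Some z)) = psl_act \<gamma> (Some (h z))"
    if "\<gamma> \<in> \<Gamma>" "z \<in> upper_half_plane" for \<gamma> z
  proof -
    have "\<gamma> \<in> carrier PSL2R"
      using that(1) assms(1) subgroup.subset unfolding fuchsian_group_def by blast
    from psl_act_upper_half_plane[OF this that(2)] show ?thesis using that(2) by (auto simp: h)
  qed
  ultimately show "h \<in> equivariant_holomorphic \<Gamma>"
    by (auto simp: equivariant_holomorphic_def h)
qed

end
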